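(* Let $E$ be a real or complex dual operator space and $K\subseteq\bigsqcup_nM_n(E)$ a closed nc convex set containing $0_E$ (i.e. $0\in K_1$). Then $K^{\circ\circ}=K$, where $K^{\circ\circ}_n=\{x\in M_n(E):\mathfrak{R}\,\varphi^{(n)}(x)\le 1_{mn}\text{ for all }m\text{ and all }\varphi\in K^\circ_m\}$.
   Context: $\mathbb{F}\in\{\mathbb{R},\mathbb{C}\}$. Nc convex sets over $E$: graded $K=\bigsqcup_nK_n$, $K_n\subseteq M_n(E)$, closed under direct sums $\sum\alpha_ix_i\alpha_i^*$ and compressions $\beta^*x\beta$ by scalar isometries (transpose in the real case); closed means each $K_n$ weak$^*$ closed. For $\varphi=[\varphi_{kl}]\in M_m(E^* )$ and $v=[v_{ij}]\in M_n(E)$, $\varphi^{(n)}(v)=[\varphi_{kl}(v_{ij})]\in M_{mn}(\mathbb{F})$, and $\mathfrak{R}\,a=\frac12(a+a^* )$. The polar is $K^\circ_m=\{\varphi\in M_m(E^* ):\mathfrak{R}\,\varphi^{(n)}(v)\le1_{mn}\text{ for all }n\text{ and }v\in K_n\}$. *)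

theory Defs
  imports "HOL-Analysis.Analysis"
begin

text \<open>A commutative real normed field with an involution satisfying x * conj x = |x|^2.
  Up to isomorphism the only such fields are R (with conj = id) and C (with conj = cnj),
  so this class is exactly the choice F in {R, C}.\<close>

class has_sconj =
  fixes sconj :: "'a \<Rightarrow> 'a"

class rcf = real_normed_field + has_sconj +
  assumes sconj_add: "sconj (x + y) = sconj x + (sconj y :: 'a)"
    and sconj_mult: "sconj (x * y) = sconj x * sconj y"
    and sconj_sconj: "sconj (sconj x) = x"
    and sconj_of_real: "sconj (scaleR r 1) = scaleR r 1"
    and mult_sconj: "x * sconj x = scaleR ((norm x)\<^sup>2) 1"

instantiation real :: rcf
begin
definition sconj_real :: "real \<Rightarrow> real" where "sconj_real x = x"
instance by standard (simp_all add: sconj_real_def power2_eq_square)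
end

instantiation complex :: rcf
begin
definition sconj_complex :: "complex \<Rightarrow> complex" where "sconj_complex x = cnj x"
instance
  apply standard
      apply (simp_all add: sconj_complex_def scaleR_conv_of_real)
  by (simp add: complex_norm_square[symmetric])
end

definition is_norm :: "('f::real_normed_field \<Rightarrow> 'x::ab_group_add \<Rightarrow> 'x) \<Rightarrow> ('x \<Rightarrow> real) \<Rightarrow> bool" where
  "is_norm sX nX \<longleftrightarrow> (\<forall>x. nX x \<ge> 0) \<and> (\<forall>x y. nX (x + y) \<le> nX x + nX y)
     \<and> (\<forall>a x. nX (sX a x) = norm a * nX x) \<and> (\<forall>x. nX x = 0 \<longrightarrow> x = 0)"

text \<open>E: bounded linear functionals on X (with the weak* topology of pointwise convergence).\<close>
definition bdual :: "('f::real_normed_field \<Rightarrow> 'x::ab_group_add \<Rightarrow> 'x) \<Rightarrow> ('x \<Rightarrow> real) \<Rightarrow> ('x \<Rightarrow> 'f) set" where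
  "bdual sX nX = {f. (\<forall>x y. f (x + y) = f x + f y) \<and> (\<forall>a x. f (sX a x) = a * f x)
                     \<and> (\<exists>C. \<forall>x. norm (f x) \<le> C * nX x)}"

text \<open>E^*: bounded linear functionals on E (E carrying the dual norm
  ||f|| = inf of the D >= 0 with |f x| <= D ||x|| for all x).\<close>
definition bdual2 :: "('f::real_normed_field \<Rightarrow> 'x::ab_group_add \<Rightarrow> 'x) \<Rightarrow> ('x \<Rightarrow> real) \<Rightarrow> (('x \<Rightarrow> 'f) \<Rightarrow> 'f) set" where
  "bdual2 sX nX = {\<psi>.
     (\<forall>f\<in>bdual sX nX. \<forall>g\<in>bdual sX nX. \<psi> (\<lambda>t. f t + g t) = \<psi> f + \<psi> g)
   \<and> (\<forall>a. \<forall>f\<in>bdual sX nX. \<psi> (\<lambda>t. a * f t) = a * \<psi> f)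
   \<and> (\<exists>C. \<forall>f\<in>bdual sX nX. \<forall>D\<ge>0. (\<forall>x. norm (f x) \<le> D * nX x) \<longrightarrow> norm (\<psi> f) \<le> C * D)}"

type_synonym 'a mtx = "nat \<Rightarrow> nat \<Rightarrow> 'a"

definition mats :: "nat \<Rightarrow> 'a set \<Rightarrow> 'a \<Rightarrow> 'a mtx set" where
  "mats n S z = {A. (\<forall>i<n. \<forall>j<n. A i j \<in> S) \<and> (\<forall>i j. \<not> (i < n \<and> j < n) \<longrightarrow> A i j = z)}"

definition sc_isometry :: "nat \<Rightarrow> nat \<Rightarrow> 'f::rcf mtx \<Rightarrow> bool" where
  "sc_isometry n p \<alpha> \<longleftrightarrow> (\<forall>a<p. \<forall>b<p. (\<Sum>i<n. sconj (\<alpha> i a) * \<alpha> i b) = (if a = b then 1 else 0))"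

text \<open>nc convexity: closed under direct sums sum_i alpha_i x_i alpha_i^* (alpha_i in M_{n,N_i}
  isometries with sum_i alpha_i alpha_i^* = 1_n) and compressions beta^* x beta (beta in M_{n,m} isometry).\<close>
definition nc_convex :: "('x \<Rightarrow> 'f::rcf) set \<Rightarrow> (nat \<Rightarrow> ('x \<Rightarrow> 'f) mtx set) \<Rightarrow> bool" where
  "nc_convex E K \<longleftrightarrow>
     (\<forall>n\<ge>1. K n \<subseteq> mats n E (\<lambda>_. 0))
   \<and> (\<forall>n\<ge>1. \<forall>k::nat. \<forall>N::nat \<Rightarrow> nat. \<forall>\<alpha>::nat \<Rightarrow> 'f mtx. \<forall>x::nat \<Rightarrow> ('x \<Rightarrow> 'f) mtx.
        (\<forall>i<k. N i \<ge> 1 \<and> x i \<in> K (N i) \<and> sc_isometry n (N i) (\<alpha> i))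
        \<and> (\<forall>p<n. \<forall>q<n. (\<Sum>i<k. \<Sum>a<N i. \<alpha> i p a * sconj (\<alpha> i q a)) = (if p = q then 1 else 0))
        \<longrightarrow> (\<lambda>r s. if r < n \<and> s < n
                   then (\<lambda>t. \<Sum>i<k. \<Sum>a<N i. \<Sum>b<N i. \<alpha> i r a * x i a b t * sconj (\<alpha> i s b))
                   else (\<lambda>_. 0)) \<in> K n)
   \<and> (\<forall>n\<ge>1. \<forall>m\<ge>1. \<forall>\<beta>::'f mtx. \<forall>x\<in>K n. sc_isometry n m \<beta>
        \<longrightarrow> (\<lambda>r s. if r < m \<and> s < m
                   then (\<lambda>t. \<Sum>a<n. \<Sum>b<n. sconj (\<beta> a r) * x a b t * \<beta> b s)
                   else (\<lambda>_. 0)) \<in> K m)"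

text \<open>Each K_n is weak*-closed in M_n(E) (weak* topology = pointwise convergence on X, entrywise).\<close>
definition nc_closed :: "('x \<Rightarrow> 'f::rcf) set \<Rightarrow> (nat \<Rightarrow> ('x \<Rightarrow> 'f) mtx set) \<Rightarrow> bool" where
  "nc_closed E K \<longleftrightarrow> (\<forall>n\<ge>1. closedin (top_of_set (mats n E (\<lambda>_. 0))) (K n))"

text \<open>phi^{(n)}(v) = [phi_kl(v_ij)] in M_{mn}(F), row (k,i) ~ k*n+i, column (l,j) ~ l*n+j.\<close>
definition ampl :: "nat \<Rightarrow> nat \<Rightarrow> ('b \<Rightarrow> 'f::rcf) mtx \<Rightarrow> 'b mtx \<Rightarrow> 'f mtx" where
  "ampl m n \<phi> v = (\<lambda>r c. if r < m * n \<and> c < m * n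
      then \<phi> (r div n) (c div n) (v (r mod n) (c mod n)) else 0)"

definition Rpart :: "'f::rcf mtx \<Rightarrow> 'f mtx" where
  "Rpart A = (\<lambda>i j. (A i j + sconj (A j i)) / 2)"

definition idm :: "'f::rcf mtx" where
  "idm = (\<lambda>i j. if i = j then 1 else 0)"

definition psd :: "nat \<Rightarrow> 'f::rcf mtx \<Rightarrow> bool" where
  "psd k A \<longleftrightarrow> (\<forall>i<k. \<forall>j<k. A j i = sconj (A i j))
     \<and> (\<forall>\<xi>::nat \<Rightarrow> 'f. \<exists>r::real. r \<ge> 0 \<and> (\<Sum>i<k. \<Sum>j<k. sconj (\<xi> i) * A i j * \<xi> j) = of_real r)"

definition mle :: "nat \<Rightarrow> 'f::rcf mtx \<Rightarrow> 'f mtx \<Rightarrow> bool" where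
  "mle k A B \<longleftrightarrow> psd k (\<lambda>i j. B i j - A i j)"

definition polar :: "('x \<Rightarrow> 'f::rcf) set \<Rightarrow> (('x \<Rightarrow> 'f) \<Rightarrow> 'f) set \<Rightarrow> (nat \<Rightarrow> ('x \<Rightarrow> 'f) mtx set)
    \<Rightarrow> nat \<Rightarrow> (('x \<Rightarrow> 'f) \<Rightarrow> 'f) mtx set" where
  "polar E Es K m = {\<phi> \<in> mats m Es (\<lambda>_. 0).
      \<forall>n\<ge>1. \<forall>v\<in>K n. mle (m * n) (Rpart (ampl m n \<phi> v)) idm}"

definition bipolar :: "('x \<Rightarrow> 'f::rcf) set \<Rightarrow> (nat \<Rightarrow> (('x \<Rightarrow> 'f) \<Rightarrow> 'f) mtx set)
    \<Rightarrow> nat \<Rightarrow> ('x \<Rightarrow> 'f) mtx set" where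
  "bipolar E P n = {x \<in> mats n E (\<lambda>_. 0).
      \<forall>m\<ge>1. \<forall>\<phi>\<in>P m. mle (m * n) (Rpart (ampl m n \<phi> x)) idm}"

end

theory Submission
  imports Defs
begin

text \<open>A point \<open>x\<close> outside \<open>K\<^sub>n\<close> is separated from the weak* closed convex set \<open>K\<^sub>n\<close> by a functional
  \<open>F = [f\<^sub>i\<^sub>j]\<close> built from finitely many point evaluations: \<open>Re F < 1\<close> on \<open>K\<^sub>n\<close> and \<open>Re F(x) > 1\<close>.
  Following Effros and Winkler, a second finite-dimensional separation yields a positive definite
  \<open>Q\<close> with \<open>tr Q < Re F(x)\<close> and \<open>Re F(\<alpha>\<^sup>* v \<alpha>) \<le> tr(Q \<alpha>\<^sup>* \<alpha>)\<close> for all \<open>v \<in> K\<^sub>r\<close> and all rectangular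
  scalar \<open>\<alpha>\<close>. Writing \<open>Q = S\<^sup>* S\<close> and conjugating \<open>F\<close> with the inverse of \<open>S\<close> turns this domination
  into the statement that the conjugated matrix of functionals lies in the polar, while its value
  at \<open>x\<close>, tested against the vector formed by the entries of \<open>S\<close>, shows that \<open>x\<close> is not in the
  bipolar.\<close>

subsection \<open>The real part\<close>

lemma sconj_zero [simp]: "sconj (0::'f::rcf) = 0"
  using sconj_of_real[of 0, where 'a='f] by simp

lemma sconj_one [simp]: "sconj (1::'f::rcf) = 1"
  using sconj_of_real[of 1, where 'a='f] by simp

lemma sconj_of_real' [simp]: "sconj (of_real r) = (of_real r :: 'f::rcf)"
  by (simp add: of_real_def sconj_of_real)

lemma sconj_numeral [simp]: "sconj (numeral k) = (numeral k :: 'f::rcf)"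
  using sconj_of_real'[of "numeral k", where 'f='f] by simp

lemma sconj_minus [simp]: "sconj (- x) = - sconj (x::'f::rcf)"
  using sconj_add[of x "- x"] by (simp add: eq_neg_iff_add_eq_0 add.commute)

lemma sconj_diff: "sconj (x - y) = sconj x - sconj (y::'f::rcf)"
  using sconj_add[of x "- y"] by simp

lemma sconj_sum: "sconj (sum f A) = (\<Sum>i\<in>A. sconj (f i :: 'f::rcf))"
  by (induction A rule: infinite_finite_induct) (auto simp: sconj_add)

lemma mult_sconj': "x * sconj x = of_real ((norm (x::'f::rcf))\<^sup>2)"
  by (simp add: of_real_def mult_sconj)

text \<open>Take norms in \<open>x * sconj x = of_real ((norm x)\<^sup>2)\<close> and cancel
  \<open>norm x\<close>.\<close>

lemma norm_sconj [simp]: "norm (sconj x) = norm (x::'f::rcf)"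
proof (cases "x = 0")
  case False
  have "norm x * norm (sconj x) = norm x * norm x"
    by (metis mult_sconj' norm_mult norm_of_real abs_power2 power2_eq_square)
  then show ?thesis using False by simp
qed simp

lemma sconj_divide: "sconj (x / y) = sconj x / sconj (y::'f::rcf)"
proof (cases "y = 0")
  case False
  have "sconj y \<noteq> 0" using False norm_sconj by (metis norm_eq_zero)
  moreover have "sconj (x / y) * sconj y = sconj x"
    using False by (simp flip: sconj_mult)
  ultimately show ?thesis by (simp add: field_simps)
qed simp

text \<open>Expanding $|1 + x|^2$ shows that $x + \overline{x}$ is real.\<close>

lemma add_sconj_real: "\<exists>r. x + sconj x = (of_real r :: 'f::rcf)"
proof -
  have "of_real ((norm (1 + x))\<^sup>2) = 1 + (x + sconj x) + x * sconj x"
    unfolding mult_sconj'[symmetric] by (simp add: sconj_add algebra_simps)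
  then have "x + sconj x = of_real ((norm (1 + x))\<^sup>2 - 1 - (norm x)\<^sup>2)"
    by (simp add: mult_sconj' algebra_simps)
  then show ?thesis by blast
qed

text \<open>The scalar field is abstract, so the real part is picked out by description; existence
  is \<open>add_sconj_real\<close> and uniqueness is injectivity of \<open>of_real\<close>.\<close>

definition re :: "'f::rcf \<Rightarrow> real" where
  "re x = (THE r. x + sconj x = of_real (2 * r))"

lemma of_real_re: "of_real (2 * re x) = x + sconj (x::'f::rcf)"
proof -
  obtain r where r: "x + sconj x = of_real r" using add_sconj_real by blast
  have "re x = r / 2" unfolding re_def
    by (rule the_equality) (use r in \<open>auto simp del: of_real_mult\<close>)
  then show ?thesis using r by (simp only: mult_2 field_sum_of_halves)
qed

lemma re_unique: "x + sconj x = of_real (2 * r) \<Longrightarrow> re x = r"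
  using of_real_re[of x] by (metis of_real_eq_iff mult_left_cancel zero_neq_numeral)

lemma re_add: "re (x + y) = re x + re y"
  by (rule re_unique) (simp only: sconj_add of_real_add distrib_left of_real_re, simp)

lemma re_zero [simp]: "re 0 = 0"
  by (rule re_unique) simp

lemma re_minus: "re (- x) = - re x"
  using re_add[of x "- x"] by simp

lemma re_diff: "re (x - y) = re x - re y"
  using re_add[of x "- y"] by (simp add: re_minus)

lemma re_sum: "re (sum f A) = (\<Sum>i\<in>A. re (f i))"
  by (induction A rule: infinite_finite_induct) (auto simp: re_add)

lemma re_sconj [simp]: "re (sconj x) = re x"
  by (rule re_unique) (simp only: of_real_re sconj_sconj add.commute)

lemma re_of_real [simp]: "re (of_real r) = r"
  by (rule re_unique) simp

lemma re_of_real_mult: "re (of_real r * x) = r * re x"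
proof (rule re_unique)
  have "of_real r * x + sconj (of_real r * x) = of_real r * (x + sconj x)"
    by (simp add: sconj_mult algebra_simps)
  also have "\<dots> = of_real (2 * (r * re x))"
    unfolding of_real_re[symmetric] by simp
  finally show "of_real r * x + sconj (of_real r * x) = of_real (2 * (r * re x))" .
qed

lemma sconj_mult_self: "sconj x * x = of_real ((norm (x::'f::rcf))\<^sup>2)"
  using mult_sconj'[of x] by (simp add: mult.commute)

lemma re_norm_le: "\<bar>re x\<bar> \<le> norm x"
proof -
  have "norm (x + sconj x) \<le> 2 * norm x"
    using norm_triangle_ineq[of x "sconj x"] by simp
  then show ?thesis unfolding of_real_re[symmetric] norm_of_real by simp
qed

lemma self_adjoint_real: "sconj x = x \<Longrightarrow> x = of_real (re x)"
proof -
  assume "sconj x = x"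
  then have "2 * of_real (re x) = 2 * x" using of_real_re[of x] by simp
  then show ?thesis by simp
qed

text \<open>For real scalars the witness is $0$, for complex scalars it is the imaginary unit.\<close>

lemma imaginary_unit_exists:
  "\<exists>u::'f::rcf. \<forall>x. x = of_real (re x) + u * of_real (re (sconj u * x))"
proof (cases "\<forall>x::'f. sconj x = x")
  case True
  then show ?thesis using self_adjoint_real by (intro exI[of _ 0]) auto
next
  case False
  then obtain y :: 'f where y: "sconj y \<noteq> y" by blast
  \<comment> \<open>\<open>w\<close> is nonzero and skew, so its normalisation satisfies
    \<open>sconj i = - i\<close> and \<open>i * sconj i = 1\<close>, which together say
    \<open>i * i = - 1\<close>.\<close>
  define w where "w = y - sconj y"
  define i where "i = w / of_real (norm w)"
  have w0: "w \<noteq> 0" using y by (simp add: w_def)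
  have sw: "sconj w = - w" by (simp add: w_def sconj_diff sconj_sconj)
  then have si: "sconj i = - i" by (simp add: i_def sconj_divide)
  have ni: "norm i = 1" using w0 by (simp add: i_def norm_divide)
  have ii: "i * sconj i = 1" using mult_sconj'[of i] ni by simp
  show ?thesis
  proof (intro exI[of _ i] allI)
    fix x :: 'f
    have "2 * of_real (re x) = x + sconj x" using of_real_re[of x] by simp
    moreover have "2 * of_real (re (sconj i * x)) = sconj i * x + i * sconj x"
      using of_real_re[of "sconj i * x"] by (simp add: sconj_mult sconj_sconj)
    then have "i * (2 * of_real (re (sconj i * x))) = i * sconj i * x + i * i * sconj x"
      by (simp add: algebra_simps)
    then have "2 * (i * of_real (re (sconj i * x))) = i * sconj i * x + i * i * sconj x"
      by (simp add: ac_simps)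
    moreover have "i * i = - 1" using ii si by (metis minus_equation_iff mult_minus_right)
    ultimately have "2 * (of_real (re x) + i * of_real (re (sconj i * x))) = 2 * x"
      using ii by (simp add: distrib_left)
    then show "x = of_real (re x) + i * of_real (re (sconj i * x))"
      by (metis mult_left_cancel zero_neq_numeral)
  qed
qed

subsection \<open>Separation in finitely many coordinates\<close>

text \<open>The functional is the point of the closure of C that is nearest to the origin, obtained
  as the limit of a minimizing sequence, which is Cauchy by the parallelogram law.\<close>

lemma separate_from_zero_real:
  fixes C :: "('i \<Rightarrow> real) set"
  assumes fin: "finite I"
    and conv: "\<And>c d t. c \<in> C \<Longrightarrow> d \<in> C \<Longrightarrow> 0 \<le> t \<Longrightarrow> t \<le> 1 \<Longrightarrow>
        \<exists>e\<in>C. \<forall>i\<in>I. e i = (1 - t) * c i + t * d i"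
    and far: "\<And>c. c \<in> C \<Longrightarrow> (\<Sum>i\<in>I. (c i)\<^sup>2) \<ge> \<delta>"
  shows "\<exists>a. \<forall>c\<in>C. (\<Sum>i\<in>I. a i * c i) \<ge> \<delta>"
proof (cases "C = {}")
  case False
  define q where "q c = (\<Sum>i\<in>I. (c i)\<^sup>2)" for c :: "'i \<Rightarrow> real"
  define D where "D = Inf (q ` C)"
  have bdd: "bdd_below (q ` C)" using far by (auto simp: q_def intro: bdd_belowI[of _ \<delta>])
  have Dle: "D \<le> q c" if "c \<in> C" for c
    unfolding D_def using bdd that by (simp add: cINF_lower)
  have \<delta>D: "\<delta> \<le> D" unfolding D_def q_def using False far by (intro cINF_greatest) auto
  have "\<exists>c\<in>C. q c < D + 1 / Suc k" for k :: nat
  proof -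
    have "Inf (q ` C) < D + 1 / Suc k" by (simp add: D_def)
    then show ?thesis using False by (subst (asm) cInf_less_iff) (auto simp: bdd)
  qed
  then obtain s where sC: "s k \<in> C" and sq: "q (s k) < D + 1 / Suc k" for k :: nat
    by metis
  have cauchy_q: "(\<Sum>i\<in>I. (s j i - s k i)\<^sup>2) \<le> 2 / Suc j + 2 / Suc k" for j k
  proof -
    \<comment> \<open>The midpoint \<open>e\<close> enters the parallelogram law. Since
      \<open>D \<le> q e\<close>, two nearly minimal points must be close to each other.\<close>
    have "\<exists>e\<in>C. \<forall>i\<in>I. e i = (1 - 1/2) * s j i + 1/2 * s k i"
      by (rule conv[OF sC sC]) auto
    then obtain e where e: "e \<in> C" "\<forall>i\<in>I. e i = (1 - 1/2) * s j i + 1/2 * s k i"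
      by blast
    have "(\<Sum>i\<in>I. (s j i - s k i)\<^sup>2) = (\<Sum>i\<in>I. 2 * (s j i)\<^sup>2 + 2 * (s k i)\<^sup>2 - 4 * (e i)\<^sup>2)"
      using e(2) by (intro sum.cong) (auto simp: power2_eq_square algebra_simps)
    also have "\<dots> = 2 * q (s j) + 2 * q (s k) - 4 * q e"
      by (simp add: q_def sum.distrib sum_subtractf sum_distrib_left)
    also have "\<dots> \<le> 2 / Suc j + 2 / Suc k"
      using sq[of j] sq[of k] Dle[OF e(1)] by simp
    finally show ?thesis .
  qed
  have "Cauchy (\<lambda>k. s k i)" if "i \<in> I" for i
  proof (rule metric_CauchyI)
    fix e :: real assume "e > 0"
    then obtain M where M: "1 / Suc M < e\<^sup>2 / 4"
      using nat_approx_posE[of "e\<^sup>2 / 4"] by auto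
    show "\<exists>M. \<forall>m\<ge>M. \<forall>n\<ge>M. dist (s m i) (s n i) < e"
    proof (intro exI allI impI)
      fix m n assume mn: "M \<le> m" "M \<le> n"
      have "(s m i - s n i)\<^sup>2 \<le> (\<Sum>i\<in>I. (s m i - s n i)\<^sup>2)"
        using fin that by (intro member_le_sum) auto
      also have "\<dots> \<le> 2 / Suc m + 2 / Suc n" by (rule cauchy_q)
      also have "\<dots> \<le> 2 / Suc M + 2 / Suc M"
        using mn by (intro add_mono divide_left_mono) auto
      also have "\<dots> < e\<^sup>2" using M by simp
      finally have "\<bar>s m i - s n i\<bar> < \<bar>e\<bar>" by (simp flip: real_sqrt_abs)
      then show "dist (s m i) (s n i) < e" using \<open>e > 0\<close> by (simp add: dist_real_def)
    qed
  qed
  then have "\<exists>a. \<forall>i\<in>I. (\<lambda>k. s k i) \<longlonglongrightarrow> a i"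
    by (intro bchoice) (auto simp: Cauchy_convergent_iff convergent_def)
  then obtain a where a: "\<And>i. i \<in> I \<Longrightarrow> (\<lambda>k. s k i) \<longlonglongrightarrow> a i" by blast
  have qa: "q a \<le> D"
  proof (rule LIMSEQ_le)
    show "(\<lambda>k. q (s k)) \<longlonglongrightarrow> q a" unfolding q_def by (intro tendsto_intros a)
    have "(\<lambda>k. D + 1 / Suc k) \<longlonglongrightarrow> D + 0" 
      by (intro tendsto_intros LIMSEQ_inverse_real_of_nat[unfolded inverse_eq_divide])
    then show "(\<lambda>k. D + 1 / Suc k) \<longlonglongrightarrow> D" by simp
    show "\<exists>N. \<forall>n\<ge>N. q (s n) \<le> D + 1 / real (Suc n)" using sq less_imp_le by blast
  qed
  show ?thesis
  proof (intro exI[of _ a] ballI)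
    fix c assume c: "c \<in> C"
    define p where "p = (\<Sum>i\<in>I. a i * c i)"
    \<comment> \<open>The limit \<open>a\<close> need not lie in \<open>C\<close>, so the bound is
      proved on the segments from \<open>s k\<close> to \<open>c\<close> and carried over by
      continuity.\<close>
    have seg: "D \<le> (1 - t)\<^sup>2 * q a + 2 * t * (1 - t) * p + t\<^sup>2 * q c" if t: "0 \<le> t" "t \<le> 1" for t
    proof -
      have "D \<le> (\<Sum>i\<in>I. ((1 - t) * s k i + t * c i)\<^sup>2)" for k
      proof -
        obtain e where "e \<in> C" "\<forall>i\<in>I. e i = (1 - t) * s k i + t * c i"
          using conv[OF sC c t] by blast
        then show ?thesis using Dle[of e] by (simp add: q_def)
      qed
      moreover have "(\<lambda>k. \<Sum>i\<in>I. ((1 - t) * s k i + t * c i)\<^sup>2)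
          \<longlonglongrightarrow> (\<Sum>i\<in>I. ((1 - t) * a i + t * c i)\<^sup>2)"
        by (intro tendsto_intros a)
      ultimately have "D \<le> (\<Sum>i\<in>I. ((1 - t) * a i + t * c i)\<^sup>2)"
        by (meson LIMSEQ_le_const)
      also have "\<dots> = (\<Sum>i\<in>I. (1 - t)\<^sup>2 * (a i)\<^sup>2 + 2 * t * (1 - t) * (a i * c i) + t\<^sup>2 * (c i)\<^sup>2)"
        by (intro sum.cong) (auto simp: power2_eq_square algebra_simps)
      also have "\<dots> = (1 - t)\<^sup>2 * q a + 2 * t * (1 - t) * p + t\<^sup>2 * q c"
        by (simp add: q_def p_def sum.distrib sum_distrib_left)
      finally show ?thesis .
    qed
    \<comment> \<open>First-order optimality: use \<open>q a \<le> D\<close> in \<open>seg\<close>,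
      divide by \<open>t\<close>, and let \<open>t\<close> tend to 0 from the right. This gives
      \<open>p \<ge> q a\<close>, and \<open>q a \<ge> D \<ge> \<delta>\<close>.\<close>
    have "0 \<le> 2 * (p - q a) + t * (q a - 2 * p + q c)" if t: "0 < t" "t \<le> 1" for t
    proof -
      have "0 \<le> t * (2 * (p - q a) + t * (q a - 2 * p + q c))"
        using seg[of t] t qa by (simp add: power2_eq_square algebra_simps)
      then show ?thesis using t by (simp add: zero_le_mult_iff)
    qed
    then have "eventually (\<lambda>t. 0 \<le> 2 * (p - q a) + t * (q a - 2 * p + q c)) (at_right 0)"
      unfolding eventually_at_right_field by (intro exI[of _ 1]) auto
    moreover have "((\<lambda>t. 2 * (p - q a) + t * (q a - 2 * p + q c))
        \<longlongrightarrow> 2 * (p - q a) + 0 * (q a - 2 * p + q c)) (at_right 0)"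
      by (intro tendsto_intros)
    ultimately have "0 \<le> 2 * (p - q a) + 0 * (q a - 2 * p + q c)"
      by (intro tendsto_lowerbound) auto
    moreover have "D \<le> q a" using seg[of 0] by simp
    ultimately show "\<delta> \<le> (\<Sum>i\<in>I. a i * c i)" using \<delta>D by (simp add: p_def)
  qed
qed auto

text \<open>Each scalar coordinate is split into the two real numbers supplied by
  \<open>imaginary_unit_exists\<close>, and \<open>separate_from_zero_real\<close> is applied to the
  translate of \<open>C\<close> by \<open>- z\<close>. The gap \<open>\<eta>\<close> is uniform over
  \<open>C\<close>.\<close>

lemma separate_point:
  fixes C :: "('i \<Rightarrow> 'f::rcf) set"
  assumes fin: "finite I" and d0: "\<delta> > 0"
    and conv: "\<And>c d t. c \<in> C \<Longrightarrow> d \<in> C \<Longrightarrow> 0 \<le> t \<Longrightarrow> t \<le> 1 \<Longrightarrow>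
        \<exists>e\<in>C. \<forall>i\<in>I. e i = of_real (1 - t) * c i + of_real t * d i"
    and far: "\<And>c. c \<in> C \<Longrightarrow> \<exists>i\<in>I. norm (c i - z i) \<ge> \<delta>"
  shows "\<exists>a. \<exists>\<eta>>0. \<forall>c\<in>C. re (\<Sum>i\<in>I. a i * (c i - z i)) \<ge> \<eta>"
proof -
  obtain u :: 'f where u: "\<And>x. x = of_real (re x) + u * of_real (re (sconj u * x))"
    using imaginary_unit_exists by blast
  define U where "U b = (if b then sconj u else 1)" for b
  define R where "R c = (\<lambda>(i, b). re (U b * (c i - z i)))" for c :: "'i \<Rightarrow> 'f"
  \<comment> \<open>A scalar is bounded by \<open>B\<close> times the larger of its two real
    coordinates, so a coordinate at distance \<open>\<delta>\<close> leaves a real one of size at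
    least \<open>\<delta> / B\<close>.\<close>
  define B where "B = 1 + norm u"
  have B: "B > 0" by (simp add: B_def add_pos_nonneg)
  have "\<exists>a. \<forall>c\<in>R ` C. (\<Sum>k\<in>I \<times> UNIV. a k * c k) \<ge> (\<delta> / B)\<^sup>2"
  proof (rule separate_from_zero_real)
    show "finite (I \<times> (UNIV :: bool set))" using fin by simp
  next
    fix c' d' and t :: real assume *: "c' \<in> R ` C" "d' \<in> R ` C" "0 \<le> t" "t \<le> 1"
    then obtain c d where cd: "c \<in> C" "c' = R c" "d \<in> C" "d' = R d" by auto
    obtain e where e: "e \<in> C" "\<forall>i\<in>I. e i = of_real (1 - t) * c i + of_real t * d i"
      using conv[OF cd(1,3) *(3,4)] by blast
    have "R e (i, b) = (1 - t) * c' (i, b) + t * d' (i, b)" if "i \<in> I" for i b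
    proof -
      have "e i = of_real (1 - t) * c i + of_real t * d i" using e(2) that by blast
      then have "U b * (e i - z i) = of_real (1 - t) * (U b * (c i - z i)) + of_real t * (U b * (d i - z i))"
        by (simp only:) (simp add: algebra_simps)
      then show ?thesis unfolding R_def cd by (simp only: case_prod_conv re_add re_of_real_mult)
    qed
    then show "\<exists>e\<in>R ` C. \<forall>i\<in>I \<times> UNIV. e i = (1 - t) * c' i + t * d' i"
      using e(1) by auto
  next
    fix c' assume "c' \<in> R ` C"
    then obtain c where c: "c \<in> C" "c' = R c" by blast
    obtain i where i: "i \<in> I" "norm (c i - z i) \<ge> \<delta>" using far c by blast
    define m where "m = max \<bar>R c (i, False)\<bar> \<bar>R c (i, True)\<bar>"
    have "norm (c i - z i) \<le> \<bar>R c (i, False)\<bar> + norm u * \<bar>R c (i, True)\<bar>"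
      using u[of "c i - z i"] norm_triangle_ineq[of "of_real (re (c i - z i))" "u * of_real (re (sconj u * (c i - z i)))"]
      by (simp add: R_def U_def norm_mult)
    also have "\<dots> \<le> m + norm u * m"
      unfolding m_def by (intro add_mono mult_left_mono) auto
    finally have "\<delta> / B \<le> m" using i(2) B by (simp add: B_def field_simps)
    then obtain b where "\<delta> / B \<le> \<bar>R c (i, b)\<bar>" unfolding m_def by (metis max_def)
    then have "(\<delta> / B)\<^sup>2 \<le> (R c (i, b))\<^sup>2"
      using d0 B by (metis abs_ge_zero abs_le_square_iff abs_of_nonneg divide_nonneg_pos less_imp_le)
    also have "\<dots> \<le> (\<Sum>k\<in>I \<times> UNIV. (R c k)\<^sup>2)"
      using fin i by (intro member_le_sum) auto
    finally show "(\<delta> / B)\<^sup>2 \<le> (\<Sum>k\<in>I \<times> UNIV. (c' k)\<^sup>2)" by (simp add: c)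
  qed
  then obtain a where a: "\<And>c. c \<in> C \<Longrightarrow> (\<Sum>k\<in>I \<times> UNIV. a k * R c k) \<ge> (\<delta> / B)\<^sup>2" by blast
  \<comment> \<open>The two real coefficients of index \<open>i\<close> reassemble into one scalar
    coefficient, because \<open>re\<close> is additive and real-homogeneous.\<close>
  define a' where "a' i = of_real (a (i, False)) + of_real (a (i, True)) * sconj u" for i
  have "(\<Sum>k\<in>I \<times> UNIV. a k * R c k) = re (\<Sum>i\<in>I. a' i * (c i - z i))" for c
  proof -
    have "(\<Sum>k\<in>I \<times> UNIV. a k * R c k) = (\<Sum>i\<in>I. \<Sum>b\<in>UNIV. a (i, b) * R c (i, b))"
      using sum.cartesian_product[of "\<lambda>i b. a (i, b) * R c (i, b)" "UNIV :: bool set" I] by simp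
    also have "\<dots> = (\<Sum>i\<in>I. re (a' i * (c i - z i)))"
      by (intro sum.cong refl) (simp add: UNIV_bool R_def U_def a'_def distrib_right re_add re_of_real_mult mult.assoc)
    finally show ?thesis by (simp add: re_sum)
  qed
  then show ?thesis using a d0 B by (intro exI[of _ a'] exI[of _ "(\<delta> / B)\<^sup>2"]) auto
qed

subsection \<open>Gram matrices and compressions\<close>

definition gram :: "nat \<Rightarrow> 'f::rcf mtx \<Rightarrow> 'f mtx" where
  "gram r \<alpha> i j = (\<Sum>a<r. sconj (\<alpha> a i) * \<alpha> a j)"

definition qform :: "nat \<Rightarrow> 'f::rcf mtx \<Rightarrow> (nat \<Rightarrow> 'f) \<Rightarrow> 'f" where
  "qform n A \<xi> = (\<Sum>i<n. \<Sum>j<n. sconj (\<xi> i) * A i j * \<xi> j)"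

definition hermitian :: "nat \<Rightarrow> 'f::rcf mtx \<Rightarrow> bool" where
  "hermitian n A \<longleftrightarrow> (\<forall>i<n. \<forall>j<n. A j i = sconj (A i j))"

definition posdef :: "nat \<Rightarrow> 'f::rcf mtx \<Rightarrow> bool" where
  "posdef n A \<longleftrightarrow> hermitian n A \<and> (\<forall>\<xi>. (\<exists>i<n. \<xi> i \<noteq> 0) \<longrightarrow> re (qform n A \<xi>) > 0)"

lemma posdefD: "posdef n A \<Longrightarrow> i < n \<Longrightarrow> \<xi> i \<noteq> 0 \<Longrightarrow> re (qform n A \<xi>) > 0"
  unfolding posdef_def by blast

lemma qform_scale: "qform n A (\<lambda>i. of_real s * \<xi> i) = of_real (s\<^sup>2) * qform n A \<xi>"
  by (simp add: qform_def sconj_mult sum_distrib_left power2_eq_square ac_simps)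

lemma gram_sconj: "gram r \<alpha> j i = sconj (gram r \<alpha> i j)"
  by (simp add: gram_def sconj_sum sconj_mult sconj_sconj mult.commute)

lemma sum_Suc_block:
  fixes g :: "nat \<Rightarrow> nat \<Rightarrow> 'a::comm_monoid_add"
  shows "(\<Sum>i<Suc n. \<Sum>j<Suc n. g i j) =
    (\<Sum>i<n. \<Sum>j<n. g i j) + (\<Sum>i<n. g i n) + (\<Sum>j<n. g n j) + g n n"
  by (simp add: sum.distrib algebra_simps)

text \<open>Recursion on the Schur complement of the last diagonal entry.\<close>

lemma cholesky:
  assumes "posdef n A"
  shows "\<exists>S T. (\<forall>i<n. \<forall>j<n. A i j = gram n S i j)
    \<and> (\<forall>i<n. \<forall>j<n. (\<Sum>k<n. S i k * T k j) = (if i = j then 1 else 0))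
    \<and> (\<forall>i<n. \<forall>j<n. (\<Sum>k<n. T i k * S k j) = (if i = j then 1 else (0::'f::rcf)))"
  using assms
proof (induction n arbitrary: A)
  case 0 then show ?case by auto
next
  case (Suc n)
  have herm: "A j i = sconj (A i j)" if "i \<le> n" "j \<le> n" for i j
    using Suc.prems that unfolding posdef_def hermitian_def by (meson le_imp_less_Suc)
  define c where "c = re (A n n)"
  have Ann: "A n n = of_real c"
    unfolding c_def using herm[of n n] by (intro self_adjoint_real) auto
  have c0: "c > 0"
  proof -
    have "qform (Suc n) A (\<lambda>i. if i = n then 1 else 0) = A n n"
      unfolding qform_def sum_Suc_block by simp
    moreover have "re (qform (Suc n) A (\<lambda>i. if i = n then 1 else 0)) > 0"
      by (rule posdefD[OF Suc.prems, of n]) auto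
    ultimately show ?thesis by (simp add: c_def)
  qed
  define s where "s = (of_real (sqrt c) :: 'f)"
  have ss: "s * s = of_real c" using c0 unfolding s_def by (metis of_real_mult real_sqrt_mult_self abs_of_pos)
  have s0: "s \<noteq> 0" using c0 by (simp add: s_def)
  have sconjs: "sconj s = s" by (simp add: s_def)
  define A' where "A' i j = A i j - A i n * A n j / of_real c" for i j
  have "posdef n A'"
    unfolding posdef_def
  proof (intro conjI allI impI)
    show "hermitian n A'"
      unfolding hermitian_def
    proof (intro allI impI)
      fix i j assume "i < n" "j < n"
      then show "A' j i = sconj (A' i j)"
        using herm[of i j] herm[of n j] herm[of i n]
        by (simp add: A'_def sconj_diff sconj_divide sconj_mult sconj_sconj mult.commute)
    qed
    fix \<xi> :: "nat \<Rightarrow> 'f" assume nz: "\<exists>i<n. \<xi> i \<noteq> 0"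
    define u where "u = (\<Sum>j<n. A n j * \<xi> j)"
    \<comment> \<open>The last coordinate completes the square: with this value the form of
      \<open>A\<close> at \<open>\<zeta>\<close> equals the form of the Schur complement
      \<open>A'\<close> at \<open>\<xi>\<close>.\<close>
    define \<zeta> where "\<zeta> i = (if i < n then \<xi> i else - u / of_real c)" for i
    have su: "sconj u = (\<Sum>i<n. sconj (\<xi> i) * A i n)"
      unfolding u_def sconj_sum using herm[of n] by (intro sum.cong) (auto simp: sconj_mult mult.commute)
    have "qform (Suc n) A \<zeta> = (\<Sum>i<n. \<Sum>j<n. sconj (\<xi> i) * A i j * \<xi> j)
       + (\<Sum>i<n. sconj (\<xi> i) * A i n * \<zeta> n) + (\<Sum>j<n. sconj (\<zeta> n) * A n j * \<xi> j) + sconj (\<zeta> n) * A n n * \<zeta> n"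
      unfolding qform_def sum_Suc_block by (simp add: \<zeta>_def)
    also have "(\<Sum>i<n. sconj (\<xi> i) * A i n * \<zeta> n) = sconj u * \<zeta> n"
      by (simp add: su sum_distrib_right)
    also have "(\<Sum>j<n. sconj (\<zeta> n) * A n j * \<xi> j) = sconj (\<zeta> n) * u"
      by (simp add: u_def sum_distrib_left mult.assoc)
    also have "(\<Sum>i<n. \<Sum>j<n. sconj (\<xi> i) * A i j * \<xi> j) + sconj u * \<zeta> n + sconj (\<zeta> n) * u + sconj (\<zeta> n) * A n n * \<zeta> n
       = (\<Sum>i<n. \<Sum>j<n. sconj (\<xi> i) * A i j * \<xi> j) - sconj u * u / of_real c"
      using c0 by (simp add: \<zeta>_def sconj_divide Ann field_simps)
    also have "sconj u * u / of_real c = (\<Sum>i<n. \<Sum>j<n. sconj (\<xi> i) * (A i n * A n j / of_real c) * \<xi> j)"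
      unfolding su unfolding u_def sum_product sum_divide_distrib by (intro sum.cong) (auto simp: ac_simps)
    finally have "qform (Suc n) A \<zeta> = qform n A' \<xi>"
      by (simp add: qform_def A'_def sum_subtractf left_diff_distrib right_diff_distrib)
    moreover have "re (qform (Suc n) A \<zeta>) > 0"
    proof -
      obtain i where "i < n" "\<xi> i \<noteq> 0" using nz by blast
      then show ?thesis by (intro posdefD[OF Suc.prems, of i]) (auto simp: \<zeta>_def)
    qed
    ultimately show "0 < re (qform n A' \<xi>)" by simp
  qed
  then obtain S T where
    S: "\<forall>i<n. \<forall>j<n. A' i j = gram n S i j" and
    ST: "\<forall>i<n. \<forall>j<n. (\<Sum>k<n. S i k * T k j) = (if i = j then 1 else 0)" and
    TS: "\<forall>i<n. \<forall>j<n. (\<Sum>k<n. T i k * S k j) = (if i = j then 1 else 0)"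
    by (elim Suc.IH[THEN exE] exE conjE) (rule that)
  \<comment> \<open>The new last row restores the rank-one term removed in \<open>A'\<close>, and
    its last entry is \<open>c / s = s\<close>. \<open>T'\<close> is the inverse of this block
    triangular matrix. Both products are carried through the induction because the final argument
    uses each of them.\<close>
  define S' where "S' i j = (if i < n then if j < n then S i j else 0 else A n j / s)" for i j
  define T' where "T' i j = (if i < n then if j < n then T i j else 0
     else if j < n then - (\<Sum>k<n. A n k * T k j) / of_real c else 1 / s)" for i j
  have 1: "A i j = gram (Suc n) S' i j" if "i < Suc n" "j < Suc n" for i j
  proof -
    have "gram (Suc n) S' i j = (\<Sum>a<n. sconj (S' a i) * S' a j) + A i n * A n j / of_real c"
      using that herm[of n i] s0 by (simp add: gram_def S'_def sconj_divide sconjs ss sconj_sconj flip: ss)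
    moreover have "(\<Sum>a<n. sconj (S' a i) * S' a j) = (if i < n \<and> j < n then gram n S i j else 0)"
      by (auto simp: gram_def S'_def intro!: sum.neutral)
    moreover have "A i n * A n j / of_real c = A i j" if "i = n \<or> j = n"
      using that c0 Ann by auto
    ultimately show ?thesis using that S[rule_format, of i j] by (auto simp: A'_def less_Suc_eq diff_eq_eq)
  qed
  have 2: "(\<Sum>k<Suc n. S' i k * T' k j) = (if i = j then 1 else 0)" if "i < Suc n" "j < Suc n" for i j
  proof (cases "i < n"; cases "j < n")
    assume "\<not> i < n" "j < n"
    then have "(\<Sum>k<Suc n. S' i k * T' k j) = (\<Sum>k<n. A n k / s * T k j) - of_real c / s * ((\<Sum>k<n. A n k * T k j) / of_real c)"
      by (simp add: S'_def T'_def Ann)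
    also have "\<dots> = 0" using c0 by (simp flip: sum_divide_distrib)
    finally show ?thesis using \<open>\<not> i < n\<close> \<open>j < n\<close> by auto
  next
    assume "\<not> i < n" "\<not> j < n"
    then show ?thesis using that c0 s0 by (simp add: S'_def T'_def Ann ss[symmetric])
  qed (use ST that in \<open>auto simp: S'_def T'_def\<close>)
  have 3: "(\<Sum>k<Suc n. T' i k * S' k j) = (if i = j then 1 else 0)" if "i < Suc n" "j < Suc n" for i j
  proof (cases "i < n"; cases "j < n")
    assume ij: "\<not> i < n" "j < n"
    then have "(\<Sum>k<Suc n. T' i k * S' k j) = - (\<Sum>k<n. (\<Sum>l<n. A n l * T l k) * S k j) / of_real c + A n j / of_real c"
      using s0 by (simp add: S'_def T'_def sum_negf flip: ss sum_divide_distrib)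
    also have "(\<Sum>k<n. (\<Sum>l<n. A n l * T l k) * S k j) = (\<Sum>l<n. A n l * (\<Sum>k<n. T l k * S k j))"
      unfolding sum_distrib_right sum_distrib_left mult.assoc by (rule sum.swap)
    also have "\<dots> = (\<Sum>l<n. if l = j then A n l else 0)"
      using ij TS by (intro sum.cong) auto
    also have "\<dots> = A n j" using ij by simp
    finally show ?thesis using ij by auto
  next
    assume "\<not> i < n" "\<not> j < n"
    then have "i = n" "j = n" using that by auto
    then show ?thesis using c0 s0 by (simp add: S'_def T'_def Ann ss[symmetric])
  qed (use TS that in \<open>auto simp: S'_def T'_def\<close>)
  show ?case by (intro exI[of _ S'] exI[of _ T'] conjI allI impI 1 2 3)
qed

section \<open>Rectangular compressions and direct sums inside an nc convex set\<close>

definition compr :: "nat \<Rightarrow> 'f::rcf mtx \<Rightarrow> ('x \<Rightarrow> 'f) mtx \<Rightarrow> ('x \<Rightarrow> 'f) mtx" where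
  "compr r \<alpha> v i j t = (\<Sum>a<r. \<Sum>b<r. sconj (\<alpha> a i) * v a b t * \<alpha> b j)"

text \<open>No size is recorded for \<open>w\<close>: entries beyond the second block vanish because
  a member of \<open>mats\<close> is zero out of range.\<close>

definition dsum :: "nat \<Rightarrow> ('x \<Rightarrow> 'f::rcf) mtx \<Rightarrow> ('x \<Rightarrow> 'f) mtx \<Rightarrow> ('x \<Rightarrow> 'f) mtx" where
  "dsum r v w i j = (if i < r \<and> j < r then v i j else if r \<le> i \<and> r \<le> j then w (i - r) (j - r) else (\<lambda>_. 0))"

definition stack :: "nat \<Rightarrow> 'f mtx \<Rightarrow> 'f mtx \<Rightarrow> 'f mtx" where
  "stack r \<alpha> \<beta> a = (if a < r then \<alpha> a else \<beta> (a - r))"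

lemma sum_lessThan_plus:
  fixes f :: "nat \<Rightarrow> 'a::comm_monoid_add"
  shows "sum f {..<r + s} = sum f {..<r} + (\<Sum>a<s. f (r + a))"
  by (induction s) (simp_all add: add.assoc)

lemma gram_stack: "gram (r + s) (stack r \<alpha> \<beta>) i j = gram r \<alpha> i j + gram s \<beta> i j"
  by (simp add: gram_def sum_lessThan_plus stack_def)

lemma compr_stack:
  "compr (r + s) (stack r \<alpha> \<beta>) (dsum r v w) i j t = compr r \<alpha> v i j t + compr s \<beta> w i j t"
  by (simp add: compr_def sum_lessThan_plus stack_def dsum_def)

lemma gram_scale: "gram r (\<lambda>a i. of_real s * \<alpha> a i) i j = of_real (s\<^sup>2) * gram r \<alpha> i j"
  by (simp add: gram_def sconj_mult sum_distrib_left power2_eq_square ac_simps)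

lemma compr_scale: "compr r (\<lambda>a i. of_real s * \<alpha> a i) v i j t = of_real (s\<^sup>2) * compr r \<alpha> v i j t"
  by (simp add: compr_def sconj_mult sum_distrib_left power2_eq_square ac_simps)

lemma nc_convex_mats: "nc_convex E K \<Longrightarrow> n \<ge> 1 \<Longrightarrow> K n \<subseteq> mats n E (\<lambda>_. 0)"
  unfolding nc_convex_def by blast

lemma nc_convex_compress:
  assumes "nc_convex E K" "r \<ge> 1" "n \<ge> 1" "v \<in> K r"
    and "\<And>i j. i < n \<Longrightarrow> j < n \<Longrightarrow> gram r \<alpha> i j = (if i = j then 1 else 0)"
  shows "(\<lambda>i j. if i < n \<and> j < n then compr r \<alpha> v i j else (\<lambda>_. 0)) \<in> K n"
proof -
  have "sc_isometry r n \<alpha>" using assms(5) by (simp add: sc_isometry_def gram_def)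
  then show ?thesis using assms(1-4) unfolding nc_convex_def compr_def by blast
qed

text \<open>The embeddings onto the first \<open>r\<close> and the last \<open>s\<close> coordinates
  are isometries whose range projections add up to the identity, so this is the direct sum axiom
  with two summands.\<close>

lemma nc_convex_dsum:
  fixes K :: "nat \<Rightarrow> ('x \<Rightarrow> 'f::rcf) mtx set"
  assumes K: "nc_convex E K" and r: "r \<ge> 1" and s: "s \<ge> 1" and v: "v \<in> K r" and w: "w \<in> K s"
  shows "dsum r v w \<in> K (r + s)"
proof -
  define N where "N i = (if i = 0 then r else s)" for i :: nat
  define \<alpha> where "\<alpha> i p a = (if i = 0 then if p = a then 1 else 0 else if p = r + a then 1 else (0::'f))"
    for i p a :: nat
  define x where "x i = (if i = 0 then v else w)" for i :: nat
  have "(\<forall>i<2. N i \<ge> 1 \<and> x i \<in> K (N i) \<and> sc_isometry (r + s) (N i) (\<alpha> i))"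
  proof (intro allI impI)
    fix i :: nat
    have "(\<Sum>p<r + s. sconj (\<alpha> i p a) * \<alpha> i p b) = (if a = b then 1 else 0)"
      if "a < N i" "b < N i" for a b
    proof -
      define q where "q = (if i = 0 then a else r + a)"
      have "(\<Sum>p<r + s. sconj (\<alpha> i p a) * \<alpha> i p b) = (\<Sum>p<r + s. if p = q then if a = b then 1 else 0 else 0)"
        by (intro sum.cong refl) (auto simp: \<alpha>_def q_def)
      moreover have "q < r + s" using that by (auto simp: q_def N_def split: if_splits)
      ultimately show ?thesis by simp
    qed
    then show "N i \<ge> 1 \<and> x i \<in> K (N i) \<and> sc_isometry (r + s) (N i) (\<alpha> i)"
      using r s v w by (auto simp: N_def x_def sc_isometry_def)
  qed
  moreover have "(\<Sum>i<2. \<Sum>a<N i. \<alpha> i p a * sconj (\<alpha> i q a)) = (if p = q then 1 else 0)"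
    if "p < r + s" "q < r + s" for p q
  proof -
    have "(\<Sum>a<r. \<alpha> 0 p a * sconj (\<alpha> 0 q a)) = (\<Sum>a<r. if a = p then if p = q then 1 else 0 else 0)"
      by (intro sum.cong) (auto simp: \<alpha>_def)
    \<comment> \<open>Truncated subtraction sends every \<open>p < r\<close> to index 0, hence the
      guard \<open>p \<ge> r\<close>.\<close>
    moreover have "(\<Sum>a<s. \<alpha> 1 p a * sconj (\<alpha> 1 q a)) = (\<Sum>a<s. if a = p - r then if p = q \<and> p \<ge> r then 1 else 0 else 0)"
      using that by (intro sum.cong) (auto simp: \<alpha>_def)
    ultimately show ?thesis using that by (auto simp: numeral_2_eq_2 N_def)
  qed
  ultimately have "(\<lambda>p q. if p < r + s \<and> q < r + s
      then (\<lambda>t. \<Sum>i<2. \<Sum>a<N i. \<Sum>b<N i. \<alpha> i p a * x i a b t * sconj (\<alpha> i q b)) else (\<lambda>_. 0)) \<in> K (r + s)"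
    using r by (intro K[unfolded nc_convex_def, THEN conjunct2, THEN conjunct1, THEN spec, THEN mp,
          THEN spec, THEN spec, THEN spec, THEN spec, THEN mp] conjI) auto
  also have "(\<lambda>p q. if p < r + s \<and> q < r + s
      then (\<lambda>t. \<Sum>i<2. \<Sum>a<N i. \<Sum>b<N i. \<alpha> i p a * x i a b t * sconj (\<alpha> i q b)) else (\<lambda>_. 0)) = dsum r v w"
  proof (intro ext)
    fix p q t
    \<comment> \<open>The zero padding of \<open>v\<close> and \<open>w\<close> is what makes the
      two matrices agree at out-of-range indices as well.\<close>
    have v0: "v a b = (\<lambda>_. 0)" if "\<not> (a < r \<and> b < r)" for a b
      using nc_convex_mats[OF K r] v that by (auto simp: mats_def)
    have w0: "w a b = (\<lambda>_. 0)" if "\<not> (a < s \<and> b < s)" for a b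
      using nc_convex_mats[OF K s] w that by (auto simp: mats_def)
    have V: "(\<Sum>a<r. \<Sum>b<r. \<alpha> 0 p a * v a b t * sconj (\<alpha> 0 q b)) = (if p < r \<and> q < r then v p q t else 0)"
    proof -
      have "(\<Sum>a<r. \<Sum>b<r. \<alpha> 0 p a * v a b t * sconj (\<alpha> 0 q b))
        = (\<Sum>a<r. \<Sum>b<r. if b = q then if a = p then v p q t else 0 else 0)"
        by (intro sum.cong refl) (auto simp: \<alpha>_def)
      then show ?thesis by (cases "q < r") auto
    qed
    have W: "(\<Sum>a<s. \<Sum>b<s. \<alpha> 1 p a * w a b t * sconj (\<alpha> 1 q b))
        = (if r \<le> p \<and> r \<le> q then w (p - r) (q - r) t else 0)"
    proof -
      have "(\<Sum>a<s. \<Sum>b<s. \<alpha> 1 p a * w a b t * sconj (\<alpha> 1 q b))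
        = (\<Sum>a<s. \<Sum>b<s. if b = q - r then if a = p - r then if r \<le> p \<and> r \<le> q
            then w (p - r) (q - r) t else 0 else 0 else 0)"
        by (intro sum.cong refl) (auto simp: \<alpha>_def)
      then show ?thesis using w0[of "p - r" "q - r"] by (cases "q - r < s"; cases "p - r < s") auto
    qed
    show "(if p < r + s \<and> q < r + s
      then (\<lambda>t. \<Sum>i<2. \<Sum>a<N i. \<Sum>b<N i. \<alpha> i p a * x i a b t * sconj (\<alpha> i q b)) else (\<lambda>_. 0)) t = dsum r v w p q t"
      using v0[of p q] w0[of "p - r" "q - r"] V W
      by (cases "p - r < s"; cases "q - r < s") (auto simp: numeral_2_eq_2 N_def x_def dsum_def)
  qed
  finally show ?thesis .
qed

text \<open>The block column of \<open>\<alpha>\<close> and \<open>\<beta>\<close> is an isometry compressing the direct sum.\<close>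

lemma nc_convex_combination:
  assumes K: "nc_convex E K" and "r \<ge> 1" "s \<ge> 1" "n \<ge> 1" and v: "v \<in> K r" and w: "w \<in> K s"
    and iso: "\<And>i j. i < n \<Longrightarrow> j < n \<Longrightarrow> gram r \<alpha> i j + gram s \<beta> i j = (if i = j then 1 else 0)"
  shows "(\<lambda>i j. if i < n \<and> j < n then (\<lambda>t. compr r \<alpha> v i j t + compr s \<beta> w i j t) else (\<lambda>_. 0)) \<in> K n"
proof -
  have "(\<lambda>i j. if i < n \<and> j < n then compr (r + s) (stack r \<alpha> \<beta>) (dsum r v w) i j else (\<lambda>_. 0)) \<in> K n"
    using assms by (intro nc_convex_compress[OF K]) (auto simp: gram_stack intro: nc_convex_dsum)
  then show ?thesis by (simp add: compr_stack[abs_def] ext cong: if_cong)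
qed

text \<open>Zero blocks of size 1 are appended one at a time. The zero matrices later serve to
  complete contractions to isometries without changing a compression.\<close>

lemma nc_convex_zero:
  assumes K: "nc_convex E K" and 0: "(\<lambda>_ _ _. 0) \<in> K 1" and "n \<ge> 1"
  shows "(\<lambda>_ _ _. 0) \<in> K n"
  using \<open>n \<ge> 1\<close>
proof (induction n rule: dec_induct)
  case (step n)
  have "dsum n (\<lambda>_ _ _. 0) (\<lambda>_ _ _. 0) \<in> K (n + 1)"
    using step 0 by (intro nc_convex_dsum[OF K]) auto
  then show ?case by (simp add: dsum_def[abs_def] cong: if_cong)
qed (use 0 in simp)

lemma compr_delta:
  assumes "i < n" "j < n"
  shows "compr n (\<lambda>a i. if a = i then of_real s else 0) v i j t = of_real (s\<^sup>2) * v i j t"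
proof -
  have "compr n (\<lambda>a i. if a = i then of_real s else 0) v i j t
    = (\<Sum>a<n. if a = i then \<Sum>b<n. if b = j then of_real (s\<^sup>2) * v i j t else 0 else 0)"
    unfolding compr_def using assms
    by (intro sum.cong refl) (auto simp: power2_eq_square if_distrib cong: if_cong)
  then show ?thesis using assms by simp
qed

lemma gram_delta:
  assumes "i < n" "j < n"
  shows "gram n (\<lambda>a i. if a = i then of_real s else 0) i j = (if i = j then of_real (s\<^sup>2) else 0)"
proof -
  have "gram n (\<lambda>a i. if a = i then of_real s else 0) i j
    = (\<Sum>a<n. if a = i then if i = j then of_real (s\<^sup>2) else 0 else 0)"
    unfolding gram_def by (intro sum.cong refl) (auto simp: power2_eq_square)
  then show ?thesis using assms by simp
qed

text \<open>Ordinary convexity of a single level: the multiples \<open>sqrt (1 - t)\<close> and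
  \<open>sqrt t\<close> of the identity have Gram matrices summing to 1.\<close>

lemma nc_convex_convex:
  fixes K :: "nat \<Rightarrow> ('x \<Rightarrow> 'f::rcf) mtx set"
  assumes K: "nc_convex E K" and n: "n \<ge> 1" and v: "v \<in> K n" and w: "w \<in> K n" and t: "0 \<le> t" "t \<le> 1"
  shows "\<exists>x\<in>K n. \<forall>i<n. \<forall>j<n. \<forall>y. x i j y = of_real (1 - t) * v i j y + of_real t * w i j y"
proof -
  let ?d = "\<lambda>s a i. if a = i then of_real (sqrt s) else (0::'f)"
  have "(\<lambda>i j. if i < n \<and> j < n then (\<lambda>y. compr n (?d (1 - t)) v i j y + compr n (?d t) w i j y) else (\<lambda>_. 0)) \<in> K n"
    using t by (intro nc_convex_combination[OF K n n n v w]) (auto simp: gram_delta simp del: of_real_diff simp flip: of_real_add)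
  then show ?thesis
    using t by (intro bexI[rotated]) (assumption, auto simp: compr_delta)
qed

subsection \<open>Weak* continuous functionals on matrices\<close>

text \<open>The general shape of a weak* continuous functional on \<open>M_n(E)\<close>: a finite
  combination of entrywise evaluations at points of the predual.\<close>

definition pairing :: "nat \<Rightarrow> 'x set \<Rightarrow> (nat \<Rightarrow> nat \<Rightarrow> 'x \<Rightarrow> 'f::rcf) \<Rightarrow> ('x \<Rightarrow> 'f) mtx \<Rightarrow> 'f" where
  "pairing n T c v = (\<Sum>i<n. \<Sum>j<n. \<Sum>t\<in>T. c i j t * v i j t)"

lemma pairing_cong:
  "(\<And>i j t. i < n \<Longrightarrow> j < n \<Longrightarrow> v i j t = w i j t) \<Longrightarrow> pairing n T c v = pairing n T c w"
  unfolding pairing_def by (intro sum.cong) auto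

lemma pairing_add: "pairing n T c (\<lambda>i j t. v i j t + w i j t) = pairing n T c v + pairing n T c w"
  by (simp add: pairing_def sum.distrib distrib_left)

lemma pairing_mult: "pairing n T c (\<lambda>i j t. a * v i j t) = a * pairing n T c v"
  by (simp add: pairing_def sum_distrib_left ac_simps)

lemma pairing_mult_left: "pairing n T (\<lambda>i j t. a * c i j t) v = a * pairing n T c v"
  by (simp add: pairing_def sum_distrib_left ac_simps)

lemma pairing_zero [simp]: "pairing n T c (\<lambda>_ _ _. 0) = 0"
  by (simp add: pairing_def)

lemma pairing_compr_stack:
  "pairing n T c (compr (r + s) (stack r \<alpha> \<beta>) (dsum r v w))
    = pairing n T c (compr r \<alpha> v) + pairing n T c (compr s \<beta> w)"
  unfolding pairing_add[symmetric] by (intro pairing_cong compr_stack)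

lemma pairing_compr_scale:
  "pairing n T c (compr r (\<lambda>a i. of_real s * \<alpha> a i) v) = of_real (s\<^sup>2) * pairing n T c (compr r \<alpha> v)"
  unfolding pairing_mult[symmetric] by (intro pairing_cong compr_scale)

text \<open>A basic open set of the product topology restricts finitely many coordinates, and each
  restriction is described by finitely many tests. The tests \<open>d\<close> range over an
  arbitrary index type so that the lemma can be fed its own conclusion.\<close>

lemma open_fun_finite_nbhd:
  fixes U :: "('a \<Rightarrow> 'b::topological_space) set" and d :: "'k \<Rightarrow> 'b \<Rightarrow> 'b \<Rightarrow> real"
  assumes nbhd: "\<And>V z. open V \<Longrightarrow> z \<in> V \<Longrightarrow>
      \<exists>T \<delta>. finite T \<and> \<delta> > 0 \<and> (\<forall>y. (\<forall>t\<in>T. d t y z < \<delta>) \<longrightarrow> y \<in> V)"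
    and U: "open U" "x \<in> U"
  shows "\<exists>J \<delta>. finite J \<and> \<delta> > 0 \<and> (\<forall>y. (\<forall>k\<in>J. d (snd k) (y (fst k)) (x (fst k)) < \<delta>) \<longrightarrow> y \<in> U)"
proof -
  have "openin (product_topology (\<lambda>i. euclidean) UNIV) U" using U by (simp add: open_fun_def)
  from product_topology_open_contains_basis[OF this U(2)] obtain X where X:
    "x \<in> Pi\<^sub>E UNIV X" "\<forall>i. open (X i)" "finite {i. X i \<noteq> UNIV}" "Pi\<^sub>E UNIV X \<subseteq> U"
    by auto
  have "\<forall>i. \<exists>T \<delta>. finite T \<and> \<delta> > 0 \<and> (\<forall>y. (\<forall>t\<in>T. d t y (x i) < \<delta>) \<longrightarrow> y \<in> X i)"
    using X(1,2) by (intro allI nbhd) auto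
  then obtain T \<delta> where T: "\<And>i. finite (T i)" "\<And>i. \<delta> i > 0"
    "\<And>i y. (\<forall>t\<in>T i. d t y (x i) < \<delta> i) \<Longrightarrow> y \<in> X i" by metis
  define I where "I = {i. X i \<noteq> UNIV}"
  \<comment> \<open>The inserted 1 keeps the minimum meaningful when no coordinate is
    restricted.\<close>
  define \<epsilon> where "\<epsilon> = Min (insert 1 (\<delta> ` I))"
  have I: "finite I" using X(3) by (simp add: I_def)
  have \<epsilon>: "\<epsilon> > 0" "\<And>i. i \<in> I \<Longrightarrow> \<epsilon> \<le> \<delta> i"
    using I T(2) by (auto simp: \<epsilon>_def)
  show ?thesis
  proof (intro exI[of _ "Sigma I T"] exI[of _ \<epsilon>] conjI allI impI)
    show "finite (Sigma I T)" using I T(1) by auto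
    fix y assume y: "\<forall>k\<in>Sigma I T. d (snd k) (y (fst k)) (x (fst k)) < \<epsilon>"
    have "y i \<in> X i" for i
    proof (cases "i \<in> I")
      case True
      show ?thesis
      proof (intro T(3) ballI)
        fix t assume "t \<in> T i"
        then have "d t (y i) (x i) < \<epsilon>" using y True by force
        then show "d t (y i) (x i) < \<delta> i" using \<epsilon>(2)[OF True] by simp
      qed
    qed (simp add: I_def)
    then show "y \<in> U" using X(4) by auto
  qed (fact \<epsilon>(1))
qed

text \<open>Three rounds of \<open>open_fun_finite_nbhd\<close> account for the point of the
  predual, the column and the row. The scalar base case has a single test, indexed by
  \<open>unit\<close>.\<close>

lemma open_mtx_finite_nbhd:
  fixes U :: "('x \<Rightarrow> 'f::metric_space) mtx set"
  assumes "open U" "x \<in> U"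
  shows "\<exists>J \<delta>. finite J \<and> \<delta> > 0 \<and> (\<forall>y. (\<forall>(i, j, t)\<in>J. dist (y i j t) (x i j t) < \<delta>) \<longrightarrow> y \<in> U)"
proof -
  have 0: "\<exists>T \<delta>. finite (T :: unit set) \<and> \<delta> > 0 \<and> (\<forall>y. (\<forall>t\<in>T. dist y z < \<delta>) \<longrightarrow> y \<in> V)"
    if V: "open V" "z \<in> V" for V and z :: 'f
  proof -
    obtain e where "e > 0" "\<forall>y. dist y z < e \<longrightarrow> y \<in> V" 
      using V unfolding open_dist by blast
    then show ?thesis by (intro exI[of _ "{()}"] exI[of _ e]) auto
  qed
  have 1: "\<exists>T \<delta>. finite (T :: ('x \<times> unit) set) \<and> \<delta> > 0 \<and> (\<forall>y. (\<forall>k\<in>T. dist (y (fst k)) (z (fst k)) < \<delta>) \<longrightarrow> y \<in> V)"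
    if "open V" "z \<in> V" for V and z :: "'x \<Rightarrow> 'f"
    by (rule open_fun_finite_nbhd[where d = "\<lambda>_::unit. dist", OF 0 that])
  have 2: "\<exists>T \<delta>. finite (T :: (nat \<times> 'x \<times> unit) set) \<and> \<delta> > 0 \<and>
      (\<forall>y. (\<forall>k\<in>T. dist (y (fst k) (fst (snd k))) (z (fst k) (fst (snd k))) < \<delta>) \<longrightarrow> y \<in> V)"
    if "open V" "z \<in> V" for V and z :: "nat \<Rightarrow> 'x \<Rightarrow> 'f"
    by (rule open_fun_finite_nbhd[where d = "\<lambda>k y z. dist (y (fst (k :: 'x \<times> unit))) (z (fst k))", OF 1 that])
  have "\<exists>J \<delta>. finite (J :: (nat \<times> nat \<times> 'x \<times> unit) set) \<and> \<delta> > 0 \<and>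
      (\<forall>y. (\<forall>k\<in>J. dist (y (fst k) (fst (snd k)) (fst (snd (snd k)))) (x (fst k) (fst (snd k)) (fst (snd (snd k)))) < \<delta>) \<longrightarrow> y \<in> U)"
    by (rule open_fun_finite_nbhd[where d = "\<lambda>k y z. dist (y (fst k) (fst (snd (k :: nat \<times> 'x \<times> unit)))) (z (fst k) (fst (snd k)))", OF 2 assms])
  then obtain J :: "(nat \<times> nat \<times> 'x \<times> unit) set" and \<delta> where J: "finite J" "\<delta> > 0"
    "\<forall>y. (\<forall>k\<in>J. dist (y (fst k) (fst (snd k)) (fst (snd (snd k)))) (x (fst k) (fst (snd k)) (fst (snd (snd k)))) < \<delta>) \<longrightarrow> y \<in> U"
    by (elim exE conjE) (rule that)
  show ?thesis
  proof (intro exI[of _ "(\<lambda>(i, j, t, _). (i, j, t)) ` J"] exI[of _ \<delta>] conjI allI impI)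
    fix y assume y: "\<forall>(i, j, t)\<in>(\<lambda>(i, j, t, _). (i, j, t)) ` J. dist (y i j t) (x i j t) < \<delta>"
    show "y \<in> U" by (rule J(3)[rule_format]) (use y in auto)
  qed (use J in auto)
qed

text \<open>A neighbourhood of \<open>x\<close> missing \<open>K n\<close> is controlled by finitely
  many coordinates. In these coordinates \<open>K n\<close> is convex and stays at distance
  \<open>\<delta>\<close> from \<open>x\<close>, so \<open>separate_point\<close> applies.\<close>

lemma separate_from_nc_convex:
  fixes K :: "nat \<Rightarrow> ('x \<Rightarrow> 'f::rcf) mtx set"
  assumes K: "nc_convex E K" and cl: "nc_closed E K" and 0: "(\<lambda>_ _ _. 0) \<in> K n" and n: "n \<ge> 1"
    and x: "x \<in> mats n E (\<lambda>_. 0)" "x \<notin> K n"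
  shows "\<exists>T c. finite T \<and> re (pairing n T c x) > 1 \<and> (\<forall>v\<in>K n. re (pairing n T c v) < 1)"
proof -
  let ?M = "mats n E (\<lambda>_. 0)"
  have "openin (top_of_set ?M) (?M - K n)"
    using cl n by (auto simp: nc_closed_def)
  then obtain U where U: "open U" "?M - K n = ?M \<inter> U" by (auto simp: openin_open)
  have "x \<in> U" using U(2) x by blast
  from open_mtx_finite_nbhd[OF U(1) this] obtain J \<delta> where J: "finite J" "\<delta> > 0"
    "\<And>y. (\<forall>(i, j, t)\<in>J. dist (y i j t) (x i j t) < \<delta>) \<Longrightarrow> y \<in> U" by blast
  define T where "T = (\<lambda>(i, j, t). t) ` J"
  define I where "I = {..<n} \<times> {..<n} \<times> T"
  define C where "C = (\<lambda>v (i, j, t). v i j t) ` K n"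
  define z where "z = (\<lambda>(i, j, t). x i j t)"
  have finT: "finite T" using J(1) by (simp add: T_def)
  have far: "\<exists>k\<in>I. norm ((\<lambda>(i, j, t). v i j t) k - z k) \<ge> \<delta>" if v: "v \<in> K n" for v
  proof (rule ccontr)
    assume neg: "\<not> ?thesis"
    have vM: "v \<in> ?M" using nc_convex_mats[OF K n] v by blast
    have "v \<in> U"
    proof (rule J(3), clarify)
      fix i j t assume ijt: "(i, j, t) \<in> J"
      show "dist (v i j t) (x i j t) < \<delta>"
      proof (cases "i < n \<and> j < n")
        case True
        then have "(i, j, t) \<in> I" using ijt by (force simp: I_def T_def)
        then show ?thesis using neg by (force simp: z_def dist_norm not_le)
      next
        \<comment> \<open>Out-of-range entries of \<open>v\<close> and \<open>x\<close> are both
          zero, so tests at such indices never distinguish them.\<close>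
        case False
        then show ?thesis using vM x(1) J(2) by (simp add: mats_def)
      qed
    qed
    then show False using U(2) v vM by blast
  qed
  have "\<exists>a. \<exists>\<eta>>0. \<forall>c\<in>C. re (\<Sum>k\<in>I. a k * (c k - z k)) \<ge> \<eta>"
  proof (rule separate_point)
    show "finite I" using finT by (simp add: I_def)
    show "\<delta> > 0" by (fact J(2))
    show "\<exists>k\<in>I. norm (c k - z k) \<ge> \<delta>" if "c \<in> C" for c
      using far that by (auto simp: C_def)
  next
    fix c d and t :: real assume "c \<in> C" "d \<in> C" and t: "0 \<le> t" "t \<le> 1"
    then obtain v w where v: "v \<in> K n" "c = (\<lambda>(i, j, t). v i j t)" and w: "w \<in> K n" "d = (\<lambda>(i, j, t). w i j t)"
      by (auto simp: C_def)
    obtain u where u: "u \<in> K n" "\<forall>i<n. \<forall>j<n. \<forall>y. u i j y = of_real (1 - t) * v i j y + of_real t * w i j y"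
      using nc_convex_convex[OF K n v(1) w(1) t] by blast
    show "\<exists>e\<in>C. \<forall>i\<in>I. e i = of_real (1 - t) * c i + of_real t * d i"
    proof (rule bexI)
      show "(\<lambda>(i, j, t). u i j t) \<in> C" using u(1) by (simp add: C_def)
      show "\<forall>i\<in>I. (\<lambda>(i, j, t). u i j t) i = of_real (1 - t) * c i + of_real t * d i"
        unfolding v w I_def using u(2) by (simp only: split_paired_Ball_Sigma) simp
    qed
  qed
  then obtain a \<eta> where a: "\<eta> > 0" "\<And>v. v \<in> K n \<Longrightarrow> re (\<Sum>(i, j, t)\<in>I. a (i, j, t) * (v i j t - x i j t)) \<ge> \<eta>"
    by (auto simp: C_def z_def split_beta)
  define c where "c = (\<lambda>i j t. - a (i, j, t))"
  have "(\<Sum>(i, j, t)\<in>I. a (i, j, t) * (v i j t - x i j t)) = pairing n T c x - pairing n T c v" for v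
    unfolding I_def pairing_def c_def
    by (simp add: sum.cartesian_product[symmetric] sum_subtractf sum_negf right_diff_distrib)
  then have sep: "re (pairing n T c v) + \<eta> \<le> re (pairing n T c x)" if "v \<in> K n" for v
    using a(2)[OF that] by (simp add: re_diff)
  \<comment> \<open>The threshold lies halfway inside the gap of width \<open>\<eta>\<close> below
    the value at \<open>x\<close>. It is positive since \<open>0\<close> belongs to
    \<open>K n\<close>, so dividing by it moves the threshold to 1.\<close>
  define s where "s = re (pairing n T c x) - \<eta> / 2"
  have s: "s > 0" using sep[OF 0] a(1) by (simp add: s_def)
  define c' where "c' = (\<lambda>i j t. of_real (1 / s) * c i j t)"
  have c': "re (pairing n T c' v) = re (pairing n T c v) / s" for v
    unfolding c'_def pairing_mult_left re_of_real_mult by simp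
  show ?thesis
  proof (intro exI[of _ T] exI[of _ c'] conjI ballI finT)
    show "re (pairing n T c' x) > 1" using s a(1) by (simp add: c' s_def)
    fix v assume "v \<in> K n"
    then show "re (pairing n T c' v) < 1" using sep[of v] s a(1) by (simp add: c' s_def)
  qed
qed

subsection \<open>Domination by a positive definite matrix\<close>

text \<open>This is \<open>tr(P^T A)\<close>. Without a transpose in the formula, pairing with a
  Gram matrix gives the sum of \<open>qform n P\<close> over the rows of
  \<open>\<alpha>\<close>.\<close>

definition frob :: "nat \<Rightarrow> 'f::rcf mtx \<Rightarrow> 'f mtx \<Rightarrow> 'f" where
  "frob n P A = (\<Sum>i<n. \<Sum>j<n. P i j * A i j)"

lemma frob_gram: "frob n P (gram r \<alpha>) = (\<Sum>a<r. qform n P (\<alpha> a))"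
proof -
  have "frob n P (gram r \<alpha>) = (\<Sum>i<n. \<Sum>j<n. \<Sum>a<r. sconj (\<alpha> a i) * P i j * \<alpha> a j)"
    by (simp add: frob_def gram_def sum_distrib_left ac_simps)
  also have "\<dots> = (\<Sum>i<n. \<Sum>a<r. \<Sum>j<n. sconj (\<alpha> a i) * P i j * \<alpha> a j)"
    by (intro sum.cong refl sum.swap)
  also have "\<dots> = (\<Sum>a<r. qform n P (\<alpha> a))" unfolding qform_def by (rule sum.swap)
  finally show ?thesis .
qed

text \<open>Against a hermitian \<open>A\<close>, the conjugate transpose of \<open>a\<close> gives
  the conjugate value and hence the same real part. The coefficients of a separating functional may
  therefore be symmetrised.\<close>

lemma frob_hermitian_part:
  assumes "hermitian n A"
  shows "re (frob n (\<lambda>i j. (a i j + sconj (a j i)) / 2) A) = re (frob n a A)"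
proof -
  have "frob n (\<lambda>i j. sconj (a j i)) A = (\<Sum>i<n. \<Sum>j<n. sconj (a j i * A j i))"
    unfolding frob_def
  proof (intro sum.cong refl)
    fix i j assume "i \<in> {..<n}" "j \<in> {..<n}"
    then have "A i j = sconj (A j i)" using assms unfolding hermitian_def by blast
    then show "sconj (a j i) * A i j = sconj (a j i * A j i)" by (simp add: sconj_mult)
  qed
  also have "\<dots> = (\<Sum>j<n. \<Sum>i<n. sconj (a j i * A j i))" by (rule sum.swap)
  also have "\<dots> = sconj (frob n a A)" by (simp add: frob_def sconj_sum)
  finally have *: "re (frob n (\<lambda>i j. sconj (a j i)) A) = re (frob n a A)" by simp
  have "frob n (\<lambda>i j. (a i j + sconj (a j i)) / 2) A
      = of_real (1/2) * (frob n a A + frob n (\<lambda>i j. sconj (a j i)) A)"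
    by (simp add: frob_def sum_distrib_left sum.distrib[symmetric] distrib_right field_simps)
  then show ?thesis using * by (simp only: re_of_real_mult re_add) simp
qed

lemma sum_delta_square:
  "(\<Sum>i<n. \<Sum>j<n. if i = j then f i j else 0) = (\<Sum>i<(n::nat). (f i i :: 'a::comm_monoid_add))"
  by (intro sum.cong refl) auto

lemma qform_delta:
  "qform n (\<lambda>i j. if i = j then of_real \<eta> else 0) \<xi> = (of_real (\<eta> * (\<Sum>i<n. (norm (\<xi> i))\<^sup>2)) :: 'f::rcf)"
proof -
  have "qform n (\<lambda>i j. if i = j then of_real \<eta> else 0) \<xi>
    = (\<Sum>i<n. \<Sum>j<n. if i = j then of_real \<eta> * (sconj (\<xi> i) * \<xi> j) else 0)"
    unfolding qform_def by (intro sum.cong refl) auto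
  also have "\<dots> = (\<Sum>i<n. of_real (\<eta> * (norm (\<xi> i))\<^sup>2))"
    unfolding sum_delta_square by (simp add: sconj_mult_self)
  finally show ?thesis by (simp add: sum_distrib_left)
qed

lemma qform_add: "qform n (\<lambda>i j. A i j + B i j) \<xi> = qform n A \<xi> + qform n B \<xi>"
  by (simp add: qform_def sum.distrib distrib_left distrib_right)

text \<open>By the arithmetic-geometric mean inequality a perturbation with entries at most
  \<open>\<eta> / (2 * n)\<close> changes the form by at most half of \<open>\<eta>\<close> times
  the squared norm of \<open>\<xi>\<close>.\<close>

lemma posdef_near_scalar:
  assumes herm: "hermitian n B" and \<eta>: "\<eta> > 0"
    and near: "\<And>i j. i < n \<Longrightarrow> j < n \<Longrightarrow> norm (B i j - (if i = j then of_real \<eta> else 0)) \<le> \<eta> / (2 * n)"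
  shows "posdef n B"
  unfolding posdef_def
proof (intro conjI herm allI impI)
  fix \<xi> :: "nat \<Rightarrow> 'a" assume nz: "\<exists>i<n. \<xi> i \<noteq> 0"
  define D where "D i j = B i j - (if i = j then of_real \<eta> else 0)" for i j
  define N where "N = (\<Sum>i<n. (norm (\<xi> i))\<^sup>2)"
  obtain k where k: "k < n" "\<xi> k \<noteq> 0" using nz by blast
  then have n: "n > 0" by simp
  have "(norm (\<xi> k))\<^sup>2 \<le> N" unfolding N_def using k by (intro member_le_sum) auto
  then have N: "N > 0" using k by (smt (verit) zero_less_norm_iff zero_less_power)
  have "norm (qform n D \<xi>) \<le> (\<Sum>i<n. \<Sum>j<n. \<eta> / (4 * n) * ((norm (\<xi> i))\<^sup>2 + (norm (\<xi> j))\<^sup>2))"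
    unfolding qform_def
  proof (intro sum_norm_le)
    fix i j assume ij: "i \<in> {..<n}" "j \<in> {..<n}"
    have "norm (sconj (\<xi> i) * D i j * \<xi> j) = norm (D i j) * (norm (\<xi> i) * norm (\<xi> j))"
      by (simp add: norm_mult)
    also have "\<dots> \<le> \<eta> / (2 * n) * (((norm (\<xi> i))\<^sup>2 + (norm (\<xi> j))\<^sup>2) / 2)"
      using near[of i j] ij \<eta> sum_squares_bound[of "norm (\<xi> i)" "norm (\<xi> j)"]
      by (intro mult_mono) (auto simp: D_def)
    finally show "norm (sconj (\<xi> i) * D i j * \<xi> j) \<le> \<eta> / (4 * n) * ((norm (\<xi> i))\<^sup>2 + (norm (\<xi> j))\<^sup>2)"
      by simp
  qed
  also have "\<dots> = \<eta> / (4 * n) * (n * N + n * N)"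
    by (simp only: sum_distrib_left[symmetric] sum.distrib sum_constant card_lessThan N_def)
  also have "\<dots> = \<eta> / 2 * N" using n by (simp add: field_simps)
  finally have "- (\<eta> / 2 * N) \<le> re (qform n D \<xi>)" using re_norm_le[of "qform n D \<xi>"] by linarith
  moreover have "qform n B \<xi> = qform n D \<xi> + of_real (\<eta> * N)"
    unfolding N_def qform_delta[symmetric] qform_add[symmetric] by (simp add: D_def)
  then have "re (qform n B \<xi>) = re (qform n D \<xi>) + \<eta> * N"
    by (simp only: re_add re_of_real)
  moreover have "\<eta> / 2 * N < \<eta> * N" using \<eta> N by simp
  ultimately show "re (qform n B \<xi>) > 0" by linarith
qed

lemma nonneg_if_affine_bounded_below:
  assumes "\<And>\<tau>::real. \<tau> \<ge> 0 \<Longrightarrow> b + \<tau> * q \<ge> 0" shows "q \<ge> 0"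
proof (rule ccontr)
  assume q: "\<not> q \<ge> 0"
  \<comment> \<open>At this \<open>\<tau>\<close> the affine function takes the negative value
    \<open>b - \<bar>b\<bar> - 1\<close>.\<close>
  have "b + ((\<bar>b\<bar> + 1) / (- q)) * q \<ge> 0" using q by (intro assms) (simp add: divide_nonneg_neg)
  moreover have "((\<bar>b\<bar> + 1) / (- q)) * q = - (\<bar>b\<bar> + 1)" using q by simp
  ultimately show False by linarith
qed

text \<open>The separation is applied to the Gram matrices \<open>\<alpha>\<^sup>* \<alpha>\<close> with \<open>Re F(\<alpha>\<^sup>* v \<alpha>) \<ge> 1\<close>. They stay away from
  a slight contraction of the identity: if \<open>\<alpha>\<^sup>* \<alpha> < 1\<close>, completing \<open>\<alpha>\<close> to an isometry puts
  \<open>\<alpha>\<^sup>* v \<alpha>\<close> into \<open>K\<^sub>n\<close>, where \<open>Re F < 1\<close>.\<close>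

lemma nc_convex_dominated_psd:
  fixes K :: "nat \<Rightarrow> ('x \<Rightarrow> 'f::rcf) mtx set"
  assumes K: "nc_convex E K" and 0: "(\<lambda>_ _ _. 0) \<in> K 1" and n: "n \<ge> 1" and \<eta>: "0 < \<eta>" "\<eta> < 1"
    and F: "\<And>v. v \<in> K n \<Longrightarrow> re (pairing n T c v) < 1"
  shows "\<exists>Q. hermitian n Q \<and> (\<forall>\<xi>. re (qform n Q \<xi>) \<ge> 0) \<and> (1 - \<eta>) * re (\<Sum>i<n. Q i i) \<le> 1 \<and>
    (\<forall>r\<ge>1. \<forall>v\<in>K r. \<forall>\<alpha>. re (pairing n T c (compr r \<alpha> v)) \<ge> 1 \<longrightarrow> re (frob n Q (gram r \<alpha>)) \<ge> 1)"
proof -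
  define G where "G = {\<lambda>(i, j). gram r \<alpha> i j | r \<alpha> v. r \<ge> 1 \<and> v \<in> K r \<and> re (pairing n T c (compr r \<alpha> v)) \<ge> 1}"
  have GI: "(\<lambda>(i, j). gram r \<alpha> i j) \<in> G"
    if "r \<ge> 1" "v \<in> K r" "re (pairing n T c (compr r \<alpha> v)) \<ge> 1" for r \<alpha> v
    using that by (auto simp: G_def)
  define I where "I = {..<n} \<times> {..<n}"
  define z where "z = (\<lambda>(i, j :: nat). if i = j then of_real (1 - \<eta>) else (0::'f))"
  have "\<exists>a. \<exists>\<epsilon>>0. \<forall>A\<in>G. re (\<Sum>k\<in>I. a k * (A k - z k)) \<ge> \<epsilon>"
  proof (rule separate_point)
    show "finite I" by (simp add: I_def)
    show "\<eta> / (2 * n) > 0" using \<eta> n by simp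
  next
    fix A assume "A \<in> G"
    then obtain r \<alpha> v where A: "A = (\<lambda>(i, j). gram r \<alpha> i j)" "r \<ge> 1" "v \<in> K r"
      "re (pairing n T c (compr r \<alpha> v)) \<ge> 1" unfolding G_def by blast
    show "\<exists>k\<in>I. \<eta> / (2 * n) \<le> norm (A k - z k)"
    proof (rule ccontr)
      assume neg: "\<not> ?thesis"
      \<comment> \<open>If the Gram matrix were close to \<open>(1 - \<eta>) 1\<close>, then
        \<open>B\<close> would be close to \<open>\<eta> 1\<close> and so positive definite. Its
        factor \<open>S\<close> completes \<open>\<alpha>\<close> to an isometry; acting on the zero
        matrix, it does not affect the value of the functional.\<close>
      define B where "B i j = (if i = j then 1 else 0) - gram r \<alpha> i j" for i j
      have "posdef n B"
      proof (rule posdef_near_scalar[OF _ \<eta>(1)])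
        show "hermitian n B"
          unfolding hermitian_def
        proof (intro allI impI)
          fix i j
          show "B j i = sconj (B i j)"
            unfolding B_def sconj_diff gram_sconj[of r \<alpha> j i] by simp
        qed
        fix i j assume "i < n" "j < n"
        then have "(i, j) \<in> I" by (simp add: I_def)
        then have "norm (A (i, j) - z (i, j)) \<le> \<eta> / (2 * n)" using neg by (meson not_le less_imp_le)
        also have "norm (A (i, j) - z (i, j)) = norm (B i j - (if i = j then of_real \<eta> else 0))"
          by (subst norm_minus_commute) (auto simp: A z_def B_def algebra_simps)
        finally show "norm (B i j - (if i = j then of_real \<eta> else 0)) \<le> \<eta> / (2 * n)" .
      qed
      from cholesky[OF this] obtain S where S: "\<forall>i<n. \<forall>j<n. B i j = gram n S i j" by blast
      let ?x = "\<lambda>i j. if i < n \<and> j < n then (\<lambda>t. compr r \<alpha> v i j t + compr n S (\<lambda>_ _ _. 0) i j t) else (\<lambda>_. 0)"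
      have "?x \<in> K n"
        using S nc_convex_zero[OF K 0 n] A n
        by (intro nc_convex_combination[OF K]) (auto simp: B_def algebra_simps)
      moreover have "pairing n T c ?x = pairing n T c (compr r \<alpha> v)"
        by (intro pairing_cong) (simp add: compr_def)
      ultimately show False using F A(4) by force
    qed
  next
    fix A B and t :: real assume "A \<in> G" "B \<in> G" and t: "0 \<le> t" "t \<le> 1"
    then obtain r \<alpha> v s \<beta> w where A: "A = (\<lambda>(i, j). gram r \<alpha> i j)" "r \<ge> 1" "v \<in> K r"
      "re (pairing n T c (compr r \<alpha> v)) \<ge> 1" and B: "B = (\<lambda>(i, j). gram s \<beta> i j)" "s \<ge> 1" "w \<in> K s"
      "re (pairing n T c (compr s \<beta> w)) \<ge> 1" unfolding G_def by blast
    \<comment> \<open>Stacking with square-root weights realises convex combinations of Gram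
      matrices and of functional values simultaneously, so \<open>G\<close> is convex.\<close>
    let ?\<alpha> = "\<lambda>a i. of_real (sqrt (1 - t)) * \<alpha> a i" and ?\<beta> = "\<lambda>a i. of_real (sqrt t) * \<beta> a i"
    have "re (pairing n T c (compr (r + s) (stack r ?\<alpha> ?\<beta>) (dsum r v w)))
       = (1 - t) * re (pairing n T c (compr r \<alpha> v)) + t * re (pairing n T c (compr s \<beta> w))"
      using t by (simp only: pairing_compr_stack pairing_compr_scale re_add re_of_real_mult) simp
    also have "\<dots> \<ge> (1 - t) * 1 + t * 1"
      using A B t by (intro add_mono mult_left_mono) auto
    finally have "(\<lambda>(i, j). gram (r + s) (stack r ?\<alpha> ?\<beta>) i j) \<in> G"
      using A B by (intro GI[where v = "dsum r v w"] nc_convex_dsum[OF K]) auto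
    then show "\<exists>e\<in>G. \<forall>i\<in>I. e i = of_real (1 - t) * A i + of_real t * B i"
      by (rule bexI[rotated]) (use t in \<open>auto simp: gram_stack gram_scale A B\<close>)
  qed
  then obtain a \<epsilon> where \<epsilon>: "\<epsilon> > 0" and a: "\<And>A. A \<in> G \<Longrightarrow> re (\<Sum>k\<in>I. a k * (A k - z k)) \<ge> \<epsilon>"
    by blast
  define P where "P i j = (a (i, j) + sconj (a (j, i))) / 2" for i j
  have P: "hermitian n P"
    by (simp add: hermitian_def P_def sconj_divide sconj_add sconj_sconj add.commute)
  define p where "p = re (\<Sum>i<n. P i i)"
  have sepP: "re (frob n P (gram r \<alpha>)) \<ge> (1 - \<eta>) * p + \<epsilon>"
    if "r \<ge> 1" "v \<in> K r" "re (pairing n T c (compr r \<alpha> v)) \<ge> 1" for r \<alpha> v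
  proof -
    define A where "A i j = gram r \<alpha> i j - (if i = j then of_real (1 - \<eta>) else 0)" for i j
    have "\<epsilon> \<le> re (\<Sum>k\<in>I. a k * ((\<lambda>(i, j). gram r \<alpha> i j) k - z k))" by (rule a, rule GI[OF that])
    also have "(\<Sum>k\<in>I. a k * ((\<lambda>(i, j). gram r \<alpha> i j) k - z k)) = frob n (\<lambda>i j. a (i, j)) A"
      unfolding I_def frob_def sum.cartesian_product by (intro sum.cong) (auto simp: A_def z_def)
    also have "re \<dots> = re (frob n P A)"
      unfolding P_def
    proof (rule frob_hermitian_part[symmetric])
      show "hermitian n A"
        unfolding hermitian_def
      proof (intro allI impI)
        fix i j
        show "A j i = sconj (A i j)"
          unfolding A_def sconj_diff gram_sconj[of r \<alpha> j i] by (simp add: sconj_diff)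
      qed
    qed
    also have "frob n P A = frob n P (gram r \<alpha>) - (\<Sum>i<n. \<Sum>j<n. if i = j then of_real (1 - \<eta>) * P i j else 0)"
      unfolding frob_def sum_subtractf[symmetric] by (intro sum.cong refl) (auto simp: A_def algebra_simps)
    also have "re \<dots> = re (frob n P (gram r \<alpha>)) - (1 - \<eta>) * p"
      unfolding sum_delta_square p_def sum_distrib_left[symmetric] re_diff re_of_real_mult ..
    finally show ?thesis by simp
  qed
  show ?thesis
  \<comment> \<open>If no compression reaches the value 1, the last clause is vacuous and
    \<open>Q = 0\<close> will do. Otherwise a member of \<open>G\<close> is available to test the
    positivity of \<open>P\<close>.\<close>
  proof (cases "\<exists>r\<ge>1. \<exists>v\<in>K r. \<exists>\<alpha>. re (pairing n T c (compr r \<alpha> v)) \<ge> 1")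
    case False
    then show ?thesis
      by (intro exI[of _ "\<lambda>_ _. 0"]) (auto simp: hermitian_def qform_def)
  next
    case True
    then obtain r v \<alpha> where rv: "r \<ge> 1" "v \<in> K r" "re (pairing n T c (compr r \<alpha> v)) \<ge> 1" by blast
    have pos: "re (qform n P \<xi>) \<ge> 0" for \<xi>
    proof (rule nonneg_if_affine_bounded_below)
      fix \<tau> :: real assume \<tau>: "\<tau> \<ge> 0"
      \<comment> \<open>An extra row that acts on the zero of \<open>K 1\<close> leaves the
        functional unchanged but adds \<open>\<tau> * qform n P \<xi>\<close> to the pairing with
        \<open>P\<close>. The bound \<open>sepP\<close> persists for all
        \<open>\<tau> \<ge> 0\<close>, which forces the form to be nonnegative.\<close>
      let ?\<beta> = "\<lambda>(_::nat) i. of_real (sqrt \<tau>) * \<xi> i"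
      have "pairing n T c (compr (r + 1) (stack r \<alpha> ?\<beta>) (dsum r v (\<lambda>_ _ _. 0))) = pairing n T c (compr r \<alpha> v)"
        unfolding pairing_compr_stack by (simp add: compr_def pairing_def)
      then have "(1 - \<eta>) * p + \<epsilon> \<le> re (frob n P (gram (r + 1) (stack r \<alpha> ?\<beta>)))"
        using rv by (intro sepP[where v = "dsum r v (\<lambda>_ _ _. 0)"] nc_convex_dsum[OF K] 0) auto
      also have "frob n P (gram (r + 1) (stack r \<alpha> ?\<beta>)) = frob n P (gram r \<alpha>) + of_real \<tau> * qform n P \<xi>"
      proof -
        have "qform n P (\<lambda>i. of_real (sqrt \<tau>) * \<xi> i) = of_real ((sqrt \<tau>)\<^sup>2) * qform n P \<xi>"
          by (rule qform_scale)
        then show ?thesis using \<tau> by (simp add: frob_gram stack_def)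
      qed
      finally show "(re (frob n P (gram r \<alpha>)) - (1 - \<eta>) * p - \<epsilon>) + \<tau> * re (qform n P \<xi>) \<ge> 0"
        by (simp add: re_add re_of_real_mult)
    qed
    have "re (P k k) \<ge> 0" if "k < n" for k
    proof -
      have "qform n P (\<lambda>i. if i = k then 1 else 0) = (\<Sum>i<n. \<Sum>j<n. if j = k then if i = k then P i j else 0 else 0)"
        unfolding qform_def by (intro sum.cong refl) auto
      then have "qform n P (\<lambda>i. if i = k then 1 else 0) = P k k" using that by simp
      then show ?thesis using pos[of "\<lambda>i. if i = k then 1 else 0"] by simp
    qed
    then have p: "p \<ge> 0" unfolding p_def re_sum by (intro sum_nonneg) auto
    \<comment> \<open>Dividing by \<open>\<kappa>\<close> normalises the bound in
      \<open>sepP\<close> to 1, and \<open>(1 - \<eta>) * p \<le> \<kappa>\<close> becomes the trace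
      estimate.\<close>
    define \<kappa> where "\<kappa> = (1 - \<eta>) * p + \<epsilon>"
    have \<kappa>: "\<kappa> > 0" unfolding \<kappa>_def using p \<epsilon> \<eta> by (intro add_nonneg_pos) auto
    define Q where "Q i j = of_real (1 / \<kappa>) * P i j" for i j
    show ?thesis
    proof (intro exI[of _ Q] conjI allI ballI impI)
      show "hermitian n Q"
        unfolding hermitian_def
      proof (intro allI impI)
        fix i j assume "i < n" "j < n"
        then have "P j i = sconj (P i j)" using P unfolding hermitian_def by blast
        then show "Q j i = sconj (Q i j)" by (simp add: Q_def sconj_mult sconj_divide)
      qed
      fix \<xi>
      have "qform n Q \<xi> = of_real (1 / \<kappa>) * qform n P \<xi>"
        by (simp add: qform_def Q_def sum_distrib_left ac_simps)
      then show "re (qform n Q \<xi>) \<ge> 0" using pos[of \<xi>] \<kappa> by (simp only: re_of_real_mult) simp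
    next
      have "re (\<Sum>i<n. Q i i) = p / \<kappa>"
        unfolding Q_def sum_distrib_left[symmetric] re_of_real_mult by (simp add: p_def)
      then show "(1 - \<eta>) * re (\<Sum>i<n. Q i i) \<le> 1" using \<kappa> \<epsilon> by (simp add: \<kappa>_def)
    next
      fix r v \<alpha> assume "r \<ge> 1" "v \<in> K r" "re (pairing n T c (compr r \<alpha> v)) \<ge> 1"
      then have "\<kappa> \<le> re (frob n P (gram r \<alpha>))" unfolding \<kappa>_def by (rule sepP)
      moreover have "frob n Q (gram r \<alpha>) = of_real (1 / \<kappa>) * frob n P (gram r \<alpha>)"
        by (simp add: frob_def Q_def sum_distrib_left ac_simps)
      ultimately show "re (frob n Q (gram r \<alpha>)) \<ge> 1"
        using \<kappa> by (simp only: re_of_real_mult) simp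
    qed
  qed
qed

text \<open>Both sides are homogeneous of degree 2 in \<open>\<alpha>\<close>, so scaling a positive
  value to 1 turns the implication of \<open>nc_convex_dominated_psd\<close> into an inequality. A
  small multiple of the identity is added to obtain strict positivity.\<close>

lemma nc_convex_dominated_posdef:
  fixes K :: "nat \<Rightarrow> ('x \<Rightarrow> 'f::rcf) mtx set"
  assumes K: "nc_convex E K" and 0: "(\<lambda>_ _ _. 0) \<in> K 1" and n: "n \<ge> 1" and s: "s > 1"
    and F: "\<And>v. v \<in> K n \<Longrightarrow> re (pairing n T c v) < 1"
  shows "\<exists>Q. posdef n Q \<and> re (\<Sum>i<n. Q i i) < s \<and>
    (\<forall>r\<ge>1. \<forall>v\<in>K r. \<forall>\<alpha>. re (pairing n T c (compr r \<alpha> v)) \<le> re (frob n Q (gram r \<alpha>)))"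
proof -
  \<comment> \<open>Then \<open>1 / (1 - \<eta>) = (s + 1) / 2\<close> bounds the trace of
    \<open>P\<close>. Adding \<open>n * \<epsilon> = (s - 1) / 4\<close> still leaves the trace
    below \<open>s\<close>.\<close>
  define \<eta> where "\<eta> = (s - 1) / (s + 1)"
  have \<eta>: "0 < \<eta>" "\<eta> < 1" using s by (auto simp: \<eta>_def)
  obtain P where P: "hermitian n P" "\<And>\<xi>. re (qform n P \<xi>) \<ge> 0" "(1 - \<eta>) * re (\<Sum>i<n. P i i) \<le> 1"
    "\<And>r v \<alpha>. r \<ge> 1 \<Longrightarrow> v \<in> K r \<Longrightarrow> re (pairing n T c (compr r \<alpha> v)) \<ge> 1 \<Longrightarrow> re (frob n P (gram r \<alpha>)) \<ge> 1"
    using nc_convex_dominated_psd[OF K 0 n \<eta> F] by blast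
  define \<epsilon> where "\<epsilon> = (s - 1) / (4 * n)"
  have \<epsilon>: "\<epsilon> > 0" using s n by (simp add: \<epsilon>_def)
  define Q where "Q i j = P i j + (if i = j then of_real \<epsilon> else 0)" for i j
  have qQ: "re (qform n Q \<xi>) = re (qform n P \<xi>) + \<epsilon> * (\<Sum>i<n. (norm (\<xi> i))\<^sup>2)" for \<xi>
    unfolding Q_def qform_add qform_delta by (simp only: re_add re_of_real)
  have qQP: "re (qform n P \<xi>) \<le> re (qform n Q \<xi>)" for \<xi>
    unfolding qQ using \<epsilon> by (simp add: sum_nonneg)
  show ?thesis
  proof (intro exI[of _ Q] conjI allI ballI impI)
    show "posdef n Q"
      unfolding posdef_def
    proof (intro conjI allI impI)
      show "hermitian n Q"
        unfolding hermitian_def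
      proof (intro allI impI)
        fix i j assume "i < n" "j < n"
        then have "P j i = sconj (P i j)" using P(1) unfolding hermitian_def by blast
        then show "Q j i = sconj (Q i j)" by (simp add: Q_def sconj_add)
      qed
      fix \<xi> :: "nat \<Rightarrow> 'f" assume "\<exists>i<n. \<xi> i \<noteq> 0"
      then obtain i where i: "i < n" "\<xi> i \<noteq> 0" by blast
      then have "(\<Sum>i<n. (norm (\<xi> i))\<^sup>2) > 0" by (intro sum_pos2[of _ i]) auto
      then show "re (qform n Q \<xi>) > 0" unfolding qQ using P(2)[of \<xi>] \<epsilon> by (simp add: add_nonneg_pos)
    qed
    have "(\<Sum>i<n. Q i i) = (\<Sum>i<n. P i i) + of_real (n * \<epsilon>)"
      by (simp add: Q_def sum.distrib)
    then have "re (\<Sum>i<n. Q i i) = re (\<Sum>i<n. P i i) + n * \<epsilon>"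
      by (simp only: re_add re_of_real)
    moreover have "re (\<Sum>i<n. P i i) \<le> (s + 1) / 2"
      using P(3) s by (simp add: \<eta>_def field_simps)
    moreover have "n * \<epsilon> = (s - 1) / 4" using n by (simp add: \<epsilon>_def)
    ultimately show "re (\<Sum>i<n. Q i i) < s" using s by (simp add: field_simps)
  next
    fix r :: nat and v \<alpha> assume rv: "r \<ge> 1" "v \<in> K r"
    define \<sigma> where "\<sigma> = re (pairing n T c (compr r \<alpha> v))"
    have "\<sigma> \<le> re (frob n P (gram r \<alpha>))"
    proof (cases "\<sigma> > 0")
      case True
      let ?\<alpha> = "\<lambda>a i. of_real (1 / sqrt \<sigma>) * \<alpha> a i"
      have sq: "(1 / sqrt \<sigma>)\<^sup>2 = 1 / \<sigma>" using True by (simp add: power_divide)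
      have "1 \<le> re (frob n P (gram r ?\<alpha>))"
      proof (rule P(4)[OF rv])
        show "1 \<le> re (pairing n T c (compr r ?\<alpha> v))"
          unfolding pairing_compr_scale re_of_real_mult sq using True by (simp flip: \<sigma>_def)
      qed
      also have "frob n P (gram r ?\<alpha>) = of_real (1 / \<sigma>) * frob n P (gram r \<alpha>)"
        unfolding frob_def gram_scale sq by (simp add: sum_distrib_left ac_simps)
      finally show ?thesis using True by (simp only: re_of_real_mult) (simp add: field_simps)
    next
      case False
      have "re (frob n P (gram r \<alpha>)) \<ge> 0"
        unfolding frob_gram re_sum using P(2) by (intro sum_nonneg)
      then show ?thesis using False by simp
    qed
    also have "\<dots> \<le> re (frob n Q (gram r \<alpha>))"
      unfolding frob_gram re_sum by (intro sum_mono qQP)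
    finally show "re (pairing n T c (compr r \<alpha> v)) \<le> re (frob n Q (gram r \<alpha>))" by (simp add: \<sigma>_def)
  qed
qed

subsection \<open>The separating matrix of functionals\<close>

lemma sum_lessThan_mult:
  fixes g :: "nat \<Rightarrow> 'a::comm_monoid_add"
  shows "(\<Sum>p<m * r. g p) = (\<Sum>k<m. \<Sum>a<r. g (k * r + a))"
proof -
  have "(\<Sum>a<r. g (k * r + a)) = sum g {k * r..<k * r + r}" for k
    using sum.shift_bounds_nat_ivl[of g 0 "k * r" r] by (simp add: atLeast0LessThan ac_simps)
  then show ?thesis by (simp add: sum.nat_group)
qed

lemma qform_ampl:
  "qform (m * r) (ampl m r \<phi> v) \<xi> =
    (\<Sum>k<m. \<Sum>a<r. \<Sum>l<m. \<Sum>b<r. sconj (\<xi> (k * r + a)) * \<phi> k l (v a b) * \<xi> (l * r + b))"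
proof -
  have lt: "k * r + a < m * r" if "k < m" "a < r" for k a
  proof -
    have "k * r + a < Suc k * r" using that by simp
    also have "\<dots> \<le> m * r" using that by (intro mult_right_mono) auto
    finally show ?thesis .
  qed
  show ?thesis
    unfolding qform_def sum_lessThan_mult
    by (intro sum.cong refl) (auto simp: ampl_def lt)
qed

text \<open>The form of \<open>1 - Re A\<close> at \<open>\<xi>\<close> is the real number obtained
  by subtracting \<open>re (qform k A \<xi>)\<close> from the squared norm of \<open>\<xi>\<close>,
  so the matrix inequality reduces to scalar ones.\<close>

lemma mle_Rpart_idm:
  "mle k (Rpart A) idm \<longleftrightarrow> (\<forall>\<xi>. re (qform k A \<xi>) \<le> (\<Sum>i<k. (norm (\<xi> i))\<^sup>2))"
proof -
  let ?B = "\<lambda>i j. idm i j - Rpart A i j"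
  have herm: "\<forall>i<k. \<forall>j<k. ?B j i = sconj (?B i j)"
    by (auto simp: idm_def Rpart_def sconj_diff sconj_divide sconj_add sconj_sconj add.commute)
  have "qform k ?B \<xi> = of_real ((\<Sum>i<k. (norm (\<xi> i))\<^sup>2) - re (qform k A \<xi>))" for \<xi>
  proof -
    have 1: "qform k (idm :: 'a mtx) \<xi> = of_real (\<Sum>i<k. (norm (\<xi> i))\<^sup>2)"
      using qform_delta[of k 1 \<xi>] unfolding idm_def[abs_def] by (simp only: of_real_1 mult_1_left)
    have 2: "qform k (\<lambda>i j. sconj (A j i)) \<xi> = sconj (qform k A \<xi>)"
    proof -
      have "qform k (\<lambda>i j. sconj (A j i)) \<xi> = (\<Sum>j<k. \<Sum>i<k. sconj (\<xi> i) * sconj (A j i) * \<xi> j)"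
        unfolding qform_def by (rule sum.swap)
      then show ?thesis by (simp add: qform_def sconj_sum sconj_mult sconj_sconj ac_simps)
    qed
    have "qform k ?B \<xi> = qform k idm \<xi> - (qform k A \<xi> + qform k (\<lambda>i j. sconj (A j i)) \<xi>) / 2"
      by (simp add: qform_def Rpart_def sum_subtractf[symmetric] sum.distrib[symmetric] sum_divide_distrib field_simps)
    also have "\<dots> = of_real (\<Sum>i<k. (norm (\<xi> i))\<^sup>2) - of_real (2 * re (qform k A \<xi>)) / 2"
      unfolding 1 2 of_real_re ..
    finally show ?thesis by simp
  qed
  then have "(\<exists>r\<ge>0. qform k ?B \<xi> = of_real r) \<longleftrightarrow> re (qform k A \<xi>) \<le> (\<Sum>i<k. (norm (\<xi> i))\<^sup>2)" for \<xi>
    by (auto simp del: of_real_diff)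
  moreover have "mle k (Rpart A) idm \<longleftrightarrow> (\<forall>\<xi>. \<exists>r\<ge>0. qform k ?B \<xi> = of_real r)"
    using herm unfolding mle_def psd_def qform_def by blast
  ultimately show ?thesis by simp
qed

lemma qform_of_gram:
  assumes "\<forall>i<n. \<forall>j<n. Q i j = gram n S i j"
  shows "qform n Q \<xi> = of_real (\<Sum>k<n. (norm (\<Sum>j<n. S k j * \<xi> j))\<^sup>2)"
proof -
  have "qform n Q \<xi> = (\<Sum>i<n. \<Sum>j<n. \<Sum>k<n. sconj (S k i * \<xi> i) * (S k j * \<xi> j))"
    unfolding qform_def using assms
    by (intro sum.cong refl) (simp add: gram_def sum_distrib_left sum_distrib_right sconj_mult ac_simps)
  also have "\<dots> = (\<Sum>i<n. \<Sum>k<n. \<Sum>j<n. sconj (S k i * \<xi> i) * (S k j * \<xi> j))"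
    by (intro sum.cong refl sum.swap)
  also have "\<dots> = (\<Sum>k<n. \<Sum>i<n. \<Sum>j<n. sconj (S k i * \<xi> i) * (S k j * \<xi> j))"
    by (rule sum.swap)
  also have "\<dots> = (\<Sum>k<n. sconj (\<Sum>j<n. S k j * \<xi> j) * (\<Sum>j<n. S k j * \<xi> j))"
    by (simp only: sconj_sum sum_product)
  also have "\<dots> = of_real (\<Sum>k<n. (norm (\<Sum>j<n. S k j * \<xi> j))\<^sup>2)"
    by (simp add: sconj_mult_self)
  finally show ?thesis .
qed

lemma sum_pairs:
  fixes h :: "nat \<Rightarrow> nat \<Rightarrow> 'a::comm_monoid_add"
  shows "(\<Sum>i<N. \<Sum>j<N. h i j) = (\<Sum>p\<in>{..<N} \<times> {..<N}. h (fst p) (snd p))"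
  by (simp add: sum.cartesian_product split_beta)

text \<open>This is \<open>R^* [f_ij] R\<close>, where \<open>f_ij\<close> is the combination of
  evaluations at the points of \<open>T\<close> with coefficients \<open>c i j t\<close>.\<close>

definition twist :: "nat \<Rightarrow> 'x set \<Rightarrow> (nat \<Rightarrow> nat \<Rightarrow> 'x \<Rightarrow> 'f::rcf) \<Rightarrow> 'f mtx \<Rightarrow> (('x \<Rightarrow> 'f) \<Rightarrow> 'f) mtx" where
  "twist n T c R k l = (if k < n \<and> l < n
    then (\<lambda>e. \<Sum>t\<in>T. (\<Sum>i<n. \<Sum>j<n. sconj (R i k) * R j l * c i j t) * e t) else (\<lambda>_. 0))"

text \<open>Both sides are sums over the pairs \<open>(k, l)\<close>, \<open>(a, b)\<close>, \<open>(i, j)\<close> and over \<open>t\<close> of the same terms.\<close>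

lemma pairing_compr_twist:
  "(\<Sum>k<n. \<Sum>a<r. \<Sum>l<n. \<Sum>b<r. sconj (\<xi> k a) * twist n T c R k l (v a b) * \<xi> l b)
    = pairing n T c (compr r (\<lambda>a j. \<Sum>k<n. R j k * \<xi> k a) v)"
proof -
  define P where "P = {..<n} \<times> {..<n}"
  define M where "M = {..<r} \<times> {..<r}"
  define X where "X p m = sconj (\<xi> (fst p) (fst m)) * \<xi> (snd p) (snd m)" for p m
  define \<rho> where "\<rho> q p = sconj (R (fst q) (fst p)) * R (snd q) (snd p)" for q p
  define C where "C q t = c (fst q) (snd q) t" for q t
  define V where "V m t = v (fst m) (snd m) t" for m t
  have "(\<Sum>k<n. \<Sum>a<r. \<Sum>l<n. \<Sum>b<r. sconj (\<xi> k a) * twist n T c R k l (v a b) * \<xi> l b)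
     = (\<Sum>k<n. \<Sum>l<n. \<Sum>a<r. \<Sum>b<r. sconj (\<xi> k a) * twist n T c R k l (v a b) * \<xi> l b)"
    by (intro sum.cong refl sum.swap)
  also have "\<dots> = (\<Sum>p\<in>P. \<Sum>m\<in>M. X p m * (\<Sum>t\<in>T. (\<Sum>q\<in>P. \<rho> q p * C q t) * V m t))"
    unfolding sum_pairs P_def M_def
    by (intro sum.cong refl) (auto simp: twist_def X_def \<rho>_def C_def V_def sum_pairs ac_simps)
  also have "\<dots> = (\<Sum>p\<in>P. \<Sum>m\<in>M. \<Sum>t\<in>T. \<Sum>q\<in>P. C q t * X p m * \<rho> q p * V m t)"
    by (simp add: sum_distrib_left sum_distrib_right ac_simps)
  also have "\<dots> = (\<Sum>p\<in>P. \<Sum>m\<in>M. \<Sum>q\<in>P. \<Sum>t\<in>T. C q t * X p m * \<rho> q p * V m t)"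
    by (intro sum.cong refl sum.swap)
  also have "\<dots> = (\<Sum>p\<in>P. \<Sum>q\<in>P. \<Sum>m\<in>M. \<Sum>t\<in>T. C q t * X p m * \<rho> q p * V m t)"
    by (intro sum.cong refl sum.swap)
  also have "\<dots> = (\<Sum>q\<in>P. \<Sum>p\<in>P. \<Sum>m\<in>M. \<Sum>t\<in>T. C q t * X p m * \<rho> q p * V m t)"
    by (rule sum.swap)
  also have "\<dots> = (\<Sum>q\<in>P. \<Sum>p\<in>P. \<Sum>t\<in>T. \<Sum>m\<in>M. C q t * X p m * \<rho> q p * V m t)"
    by (intro sum.cong refl sum.swap)
  also have "\<dots> = (\<Sum>q\<in>P. \<Sum>t\<in>T. \<Sum>p\<in>P. \<Sum>m\<in>M. C q t * X p m * \<rho> q p * V m t)"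
    by (intro sum.cong refl sum.swap)
  also have "\<dots> = (\<Sum>q\<in>P. \<Sum>t\<in>T. \<Sum>m\<in>M. \<Sum>p\<in>P. C q t * X p m * \<rho> q p * V m t)"
    by (intro sum.cong refl sum.swap)
  also have "\<dots> = (\<Sum>q\<in>P. \<Sum>t\<in>T. C q t * (\<Sum>m\<in>M. (\<Sum>p\<in>P. \<rho> q p * X p m) * V m t))"
    by (simp add: sum_distrib_left sum_distrib_right ac_simps)
  also have "\<dots> = pairing n T c (compr r (\<lambda>a j. \<Sum>k<n. R j k * \<xi> k a) v)"
  proof -
    have "(\<Sum>p\<in>P. \<rho> q p * X p m) = sconj (\<Sum>k<n. R (fst q) k * \<xi> k (fst m)) * (\<Sum>k<n. R (snd q) k * \<xi> k (snd m))" for q m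
      unfolding sconj_sum sum_product sum_pairs P_def
      by (intro sum.cong refl) (simp add: \<rho>_def X_def sconj_mult ac_simps)
    then show ?thesis
      unfolding pairing_def compr_def sum_pairs P_def M_def
      by (simp add: C_def V_def ac_simps)
  qed
  finally show ?thesis .
qed

text \<open>Evaluation at \<open>t\<close> has norm at most \<open>nX t\<close> on the dual space,
  which gives the bound by the weighted sum of these norms.\<close>

lemma finite_evaluation_bdual2:
  fixes sX :: "'f::rcf \<Rightarrow> 'x::ab_group_add \<Rightarrow> 'x"
  assumes "finite T"
  shows "(\<lambda>e. \<Sum>t\<in>T. d t * e t) \<in> bdual2 sX nX"
  unfolding bdual2_def
proof (intro CollectI conjI ballI allI impI exI[of _ "\<Sum>t\<in>T. norm (d t) * nX t"])
  fix f :: "'x \<Rightarrow> 'f" and D assume D: "(D::real) \<ge> 0" "\<forall>x. norm (f x) \<le> D * nX x"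
  have "norm (\<Sum>t\<in>T. d t * f t) \<le> (\<Sum>t\<in>T. norm (d t) * (D * nX t))"
    using D by (intro sum_norm_le) (simp add: norm_mult mult_left_mono)
  then show "norm (\<Sum>t\<in>T. d t * f t) \<le> (\<Sum>t\<in>T. norm (d t) * nX t) * D"
    by (simp add: sum_distrib_left sum_distrib_right ac_simps)
qed (simp_all add: sum.distrib distrib_left sum_distrib_left ac_simps)

lemma twist_in_mats:
  assumes "finite T"
  shows "twist n T c R \<in> mats n (bdual2 sX nX) (\<lambda>_. 0)"
  using finite_evaluation_bdual2[OF assms] by (auto simp: mats_def twist_def)

section \<open>The bipolar lies in K\<close>

lemma bipolar_subset:
  fixes K :: "nat \<Rightarrow> ('x::ab_group_add \<Rightarrow> 'f::rcf) mtx set"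
  assumes K: "nc_convex E K" and cl: "nc_closed E K"
    and 0: "(\<lambda>_ _ _. 0) \<in> K 1" and n: "n \<ge> 1"
  shows "bipolar E (polar E (bdual2 sX nX) K) n \<subseteq> K n"
proof (rule ccontr)
  assume "\<not> ?thesis"
  then obtain x where x: "x \<in> bipolar E (polar E (bdual2 sX nX) K) n" "x \<notin> K n" by blast
  then have "x \<in> mats n E (\<lambda>_. 0)" by (simp add: bipolar_def)
  from separate_from_nc_convex[OF K cl nc_convex_zero[OF K 0 n] n this x(2)]
  obtain T c where T: "finite T" and s: "re (pairing n T c x) > 1"
    and F: "\<And>v. v \<in> K n \<Longrightarrow> re (pairing n T c v) < 1" by blast
  from nc_convex_dominated_posdef[OF K 0 n s F] obtain Q where Q: "posdef n Q"
    "re (\<Sum>i<n. Q i i) < re (pairing n T c x)"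
    and dom: "\<And>r v \<alpha>. r \<ge> 1 \<Longrightarrow> v \<in> K r \<Longrightarrow> re (pairing n T c (compr r \<alpha> v)) \<le> re (frob n Q (gram r \<alpha>))"
    by blast
  from cholesky[OF Q(1)] obtain S R where S: "\<forall>i<n. \<forall>j<n. Q i j = gram n S i j"
    and SR: "\<forall>i<n. \<forall>j<n. (\<Sum>k<n. S i k * R k j) = (if i = j then 1 else 0)"
    and RS: "\<forall>i<n. \<forall>j<n. (\<Sum>k<n. R i k * S k j) = (if i = j then 1 else 0)"
    by (elim exE conjE) (rule that)
  define \<phi> where "\<phi> = twist n T c R"
  have "\<phi> \<in> polar E (bdual2 sX nX) K n"
    unfolding polar_def mle_Rpart_idm
  proof (intro CollectI conjI allI impI ballI)
    show "\<phi> \<in> mats n (bdual2 sX nX) (\<lambda>_. 0)" unfolding \<phi>_def by (rule twist_in_mats[OF T])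
    fix r :: nat and v \<xi> assume rv: "1 \<le> r" "v \<in> K r"
    \<comment> \<open>The rows of \<open>\<alpha>\<close> are \<open>R\<close> applied to the slices
      of \<open>\<xi>\<close>. As \<open>S\<close> undoes \<open>R\<close>, the
      \<open>Q\<close>-form of these rows adds up to the squared norm of
      \<open>\<xi>\<close>.\<close>
    define \<alpha> where "\<alpha> a j = (\<Sum>k<n. R j k * \<xi> (k * r + a))" for a j
    have S\<alpha>: "(\<Sum>j<n. S k j * \<alpha> a j) = \<xi> (k * r + a)" if "k < n" for k a
    proof -
      have "(\<Sum>j<n. S k j * \<alpha> a j) = (\<Sum>j<n. \<Sum>l<n. S k j * R j l * \<xi> (l * r + a))"
        by (simp add: \<alpha>_def sum_distrib_left mult.assoc)
      also have "\<dots> = (\<Sum>l<n. (\<Sum>j<n. S k j * R j l) * \<xi> (l * r + a))"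
        unfolding sum_distrib_right by (rule sum.swap)
      also have "\<dots> = (\<Sum>l<n. if l = k then \<xi> (l * r + a) else 0)"
        using SR that by (intro sum.cong) auto
      finally show ?thesis using that by simp
    qed
    have "qform (n * r) (ampl n r \<phi> v) \<xi> = pairing n T c (compr r \<alpha> v)"
      unfolding qform_ampl \<phi>_def \<alpha>_def[abs_def] by (rule pairing_compr_twist)
    then have "re (qform (n * r) (ampl n r \<phi> v) \<xi>) \<le> re (frob n Q (gram r \<alpha>))"
      using dom[OF rv] by simp
    also have "\<dots> = (\<Sum>a<r. \<Sum>k<n. (norm (\<xi> (k * r + a)))\<^sup>2)"
      unfolding frob_gram re_sum qform_of_gram[OF S] re_of_real
      by (intro sum.cong refl) (simp add: S\<alpha>)
    also have "\<dots> = (\<Sum>p<n * r. (norm (\<xi> p))\<^sup>2)"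
      unfolding sum_lessThan_mult by (rule sum.swap)
    finally show "re (qform (n * r) (ampl n r \<phi> v) \<xi>) \<le> (\<Sum>p<n * r. (norm (\<xi> p))\<^sup>2)" .
  qed
  then have "mle (n * n) (Rpart (ampl n n \<phi> x)) idm"
    using x(1) n by (simp add: bipolar_def)
  \<comment> \<open>The test vector lists the entries of \<open>S\<close> in the index order of
    \<open>ampl\<close>. Its squared norm is the trace of \<open>Q\<close>, and
    \<open>R S = 1\<close> turns the twisted compression of \<open>x\<close> back into
    \<open>x\<close>, so \<open>tr Q\<close> would bound the value at \<open>x\<close>.\<close>
  then have "re (qform (n * n) (ampl n n \<phi> x) (\<lambda>p. S (p div n) (p mod n)))
      \<le> (\<Sum>p<n * n. (norm (S (p div n) (p mod n)))\<^sup>2)"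
    unfolding mle_Rpart_idm by blast
  also have "\<dots> = (\<Sum>a<n. \<Sum>k<n. (norm (S k a))\<^sup>2)"
    unfolding sum_lessThan_mult by (subst sum.swap) simp
  also have "\<dots> = re (\<Sum>a<n. Q a a)"
    unfolding re_sum
  proof (intro sum.cong refl)
    fix a assume "a \<in> {..<n}"
    then have "Q a a = of_real (\<Sum>k<n. (norm (S k a))\<^sup>2)"
      using S by (simp add: gram_def sconj_mult_self)
    then show "(\<Sum>k<n. (norm (S k a))\<^sup>2) = re (Q a a)" by (simp only: re_of_real)
  qed
  also have "qform (n * n) (ampl n n \<phi> x) (\<lambda>p. S (p div n) (p mod n))
      = pairing n T c (compr n (\<lambda>a j. \<Sum>k<n. R j k * S k a) x)"
    unfolding pairing_compr_twist[symmetric] qform_ampl \<phi>_def by simp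
  also have "\<dots> = pairing n T c x"
  proof (rule pairing_cong)
    fix i j t assume ij: "i < n" "j < n"
    have "compr n (\<lambda>a j. \<Sum>k<n. R j k * S k a) x i j t
        = compr n (\<lambda>a i. if a = i then of_real 1 else 0) x i j t"
      unfolding compr_def using ij RS by (intro sum.cong refl) auto
    then show "compr n (\<lambda>a j. \<Sum>k<n. R j k * S k a) x i j t = x i j t"
      by (simp add: compr_delta[OF ij])
  qed
  finally show False using Q(2) by simp
qed

theorem theorem5p2:
  fixes sX :: "'f::rcf \<Rightarrow> 'x::ab_group_add \<Rightarrow> 'x"
    and nX :: "'x \<Rightarrow> real"
    and K :: "nat \<Rightarrow> ('x \<Rightarrow> 'f) mtx set"
  assumes "vector_space sX"
    and "is_norm sX nX"
    and "nc_convex (bdual sX nX) K"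
    and "nc_closed (bdual sX nX) K"
    and "(\<lambda>_ _. (\<lambda>_. 0)) \<in> K 1"
  shows "\<forall>n\<ge>1. bipolar (bdual sX nX) (polar (bdual sX nX) (bdual2 sX nX) K) n = K n"
proof (intro allI impI equalityI)
  fix n :: nat assume n: "1 \<le> n"
  show "bipolar (bdual sX nX) (polar (bdual sX nX) (bdual2 sX nX) K) n \<subseteq> K n"
    by (rule bipolar_subset[OF assms(3-5) n])
  \<comment> \<open>The easy inclusion is the defining condition of the polar, read at a fixed point
    of \<open>K n\<close>.\<close>
  show "K n \<subseteq> bipolar (bdual sX nX) (polar (bdual sX nX) (bdual2 sX nX) K) n"
    using nc_convex_mats[OF assms(3) n] n by (auto simp: bipolar_def polar_def)
qed

end
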